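(* Let $D\subset\mathbb{R}^2$ be a connected and simply connected domain with non-empty interior, bounded by a smooth closed curve $\gamma$, and let $n\ge 1$ be an integer. Let $H$ be a smooth real-valued function on a neighborhood of $D$ which is constant on $\gamma$ and whose $j$-th normal derivatives vanish along $\gamma$ for $j=1,\dots,n-1$. Let $V_n$ be the vector field on $D$ whose two components are the real and imaginary parts of $(\partial_x+i\partial_y)^nH(x,y)$. Assume that $V_n$ has only isolated zeros in $D$ and no zeros on $\gamma$. Then $V_n$ has $n$ zeros in the interior of $D$, counted with multiplicities.
   Context: Multiplicity of an isolated zero of $V_n$ means its index; the claim is that the sum of the indices of the zeros of $V_n$ in the interior of $D$ equals $n$. The $j$-th normal derivative along $\gamma$ means $\partial_s^jH(\gamma(t)+s\,n(t))|_{s=0}$, where $\gamma(t)$ is an arc length parametrization and $n(t)$ the inward unit normal. *)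

theory Defs
  imports "HOL-Complex_Analysis.Complex_Analysis"
begin

text \<open>We identify \<open>\<real>\<^sup>2\<close> with \<open>\<complex>\<close> via \<open>(x,y) \<mapsto> x + i y\<close>.\<close>

definition pd :: "complex \<Rightarrow> (complex \<Rightarrow> complex) \<Rightarrow> complex \<Rightarrow> complex" where
  "pd v f z = vector_derivative (\<lambda>t::real. f (z + of_real t * v)) (at 0)"

definition dbar_op :: "(complex \<Rightarrow> complex) \<Rightarrow> complex \<Rightarrow> complex" where
  "dbar_op f z = pd 1 f z + \<i> * pd \<i> f z"

definition smooth_on_C :: "complex set \<Rightarrow> (complex \<Rightarrow> complex) \<Rightarrow> bool" where
  "smooth_on_C U f \<longleftrightarrow>
     (\<forall>ds. set ds \<subseteq> {1, \<i>} \<longrightarrow> (fold pd ds f) differentiable_on U)"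

definition smooth_curve :: "(real \<Rightarrow> complex) \<Rightarrow> bool" where
  "smooth_curve g \<longleftrightarrow>
     (\<forall>k. ((\<lambda>h t. vector_derivative h (at t)) ^^ k) g differentiable_on UNIV)"

text \<open>Index of an isolated zero \<open>z\<close> of a (continuous) planar vector field \<open>f\<close>:
  the winding number around \<open>0\<close> of the image under \<open>f\<close> of a small
  positively oriented circle about \<open>z\<close> (constant for all small radii).\<close>
definition zero_index :: "(complex \<Rightarrow> complex) \<Rightarrow> complex \<Rightarrow> complex" where
  "zero_index f z = (SOME k. \<forall>\<^sub>F r in at_right 0. winding_number (f \<circ> circlepath z r) 0 = k)"

end

theory Submission
  imports Defs
begin

text \<open>On the curve, with unit tangent \<open>\<tau>\<close> and normal \<open>\<nu> = i\<tau>\<close>, the hypotheses make every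
  mixed derivative of order at most \<open>n\<close> containing a tangential direction vanish, and since
  \<open>\<partial>\<^sub>x + i \<partial>\<^sub>y = \<tau> (\<partial>\<^sub>\<tau> + i \<partial>\<^sub>\<nu>)\<close> we get \<open>V\<^sub>n = \<nu>\<^sup>n \<partial>\<^sub>\<nu>\<^sup>n H\<close> there, a nonzero real multiple of
  \<open>\<nu>\<^sup>n\<close>. So \<open>V\<^sub>n\<close> winds \<open>n\<close> times as often as the tangent along the curve.

  The tangent winds as often as the curve winds around an inner point \<open>z\<close> (Hopf's Umlaufsatz):
  a parallel curve \<open>\<gamma> + h i \<tau>\<close> lies inside, hence contracts there to \<open>z\<close>, which deforms
  \<open>\<gamma> - (\<gamma> + h i \<tau>) = - h i \<tau>\<close> to \<open>\<gamma> - z\<close> through loops avoiding \<open>0\<close>.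

  Finally \<open>V\<^sub>n\<close> divided by \<open>\<Prod> (x - z\<^sub>j)\<close> to the power of the indices has winding number 0 around
  each zero \<open>z\<^sub>j\<close>, so it can be changed near the zeros to a nonvanishing function on \<open>D\<close>. This has
  a continuous logarithm because \<open>D\<close> is compact with connected complement; hence the winding
  number of \<open>V\<^sub>n\<close> along the curve is the sum of the indices times that of the curve.\<close>

subsection \<open>The argument principle for continuous functions\<close>

text \<open>Continuous logarithms of the two paths add up to one of the product, and a winding
  number about 0 is the increment of a logarithm divided by \<open>2 * pi * \<i>\<close>.\<close>

lemma winding_number_mult:
  assumes p: "path p" "0 \<notin> path_image p" and q: "path q" "0 \<notin> path_image q"
  shows "winding_number (\<lambda>t. p t * q t) 0 = winding_number p 0 + winding_number q 0"
proof -
  obtain a where a: "path a"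
    "pathfinish a - pathstart a = 2 * of_real pi * \<i> * winding_number p 0"
    "\<And>t. t \<in> {0..1} \<Longrightarrow> p t = 0 + exp (a t)"
    using winding_number_as_continuous_log[OF p] by blast
  obtain b where b: "path b"
    "pathfinish b - pathstart b = 2 * of_real pi * \<i> * winding_number q 0"
    "\<And>t. t \<in> {0..1} \<Longrightarrow> q t = 0 + exp (b t)"
    using winding_number_as_continuous_log[OF q] by blast
  have "path (\<lambda>t. a t + b t)"
    using a(1) b(1) unfolding path_def by (intro continuous_intros)
  from winding_number_compose_exp[OF this]
  have "winding_number (exp \<circ> (\<lambda>t. a t + b t)) 0
      = ((pathfinish a - pathstart a) + (pathfinish b - pathstart b)) / (2 * of_real pi * \<i>)"
    by (simp add: pathfinish_def pathstart_def algebra_simps)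
  also have "\<dots> = winding_number p 0 + winding_number q 0"
    unfolding a(2) b(2) by (simp add: field_simps)
  also have "winding_number (exp \<circ> (\<lambda>t. a t + b t)) 0 = winding_number (\<lambda>t. p t * q t) 0"
    using a(3) b(3) by (intro winding_number_cong) (simp add: exp_add)
  finally show ?thesis .
qed

text \<open>A logarithm of the path is multiplied by \<open>k\<close>. Exponents are integers of
  either sign, so that zeros of negative index can be divided out as well.\<close>

lemma winding_number_powi:
  assumes p: "path p" "0 \<notin> path_image p"
  shows "winding_number (\<lambda>t. p t powi k) 0 = of_int k * winding_number p 0"
proof -
  obtain a where a: "path a"
    "pathfinish a - pathstart a = 2 * of_real pi * \<i> * winding_number p 0"
    "\<And>t. t \<in> {0..1} \<Longrightarrow> p t = 0 + exp (a t)"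
    using winding_number_as_continuous_log[OF p] by blast
  have "path (\<lambda>t. of_int k * a t)"
    using a(1) unfolding path_def by (intro continuous_intros)
  from winding_number_compose_exp[OF this]
  have "winding_number (exp \<circ> (\<lambda>t. of_int k * a t)) 0
      = (of_int k * (pathfinish a - pathstart a)) / (2 * of_real pi * \<i>)"
    by (simp add: pathfinish_def pathstart_def algebra_simps)
  also have "\<dots> = of_int k * winding_number p 0"
    unfolding a(2) by (simp add: field_simps)
  also have "winding_number (exp \<circ> (\<lambda>t. of_int k * a t)) 0 = winding_number (\<lambda>t. p t powi k) 0"
    using a(3) by (intro winding_number_cong) (simp add: exp_power_int mult.commute)
  finally show ?thesis .
qed

lemma path_powi:
  fixes p :: "real \<Rightarrow> complex"
  assumes "path p" "0 \<notin> path_image p"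
  shows "path (\<lambda>t. p t powi k)" "0 \<notin> path_image (\<lambda>t. p t powi k)"
  using assms unfolding path_def path_image_def by (auto intro!: continuous_intros)

lemma winding_number_prod:
  assumes "finite I" "\<And>i. i \<in> I \<Longrightarrow> path (p i)" "\<And>i t. i \<in> I \<Longrightarrow> t \<in> {0..1} \<Longrightarrow> p i t \<noteq> 0"
  shows "winding_number (\<lambda>t. \<Prod>i\<in>I. p i t) 0 = (\<Sum>i\<in>I. winding_number (p i) 0)"
  using assms
proof (induction I rule: finite_induct)
  case empty
  then show ?case using winding_number_constI[of 1 0 "\<lambda>t. 1"] by simp
next
  case (insert x F)
  have "path (\<lambda>t. \<Prod>i\<in>F. p i t)" "0 \<notin> path_image (\<lambda>t. \<Prod>i\<in>F. p i t)"
    using insert by (auto simp: path_def path_image_def intro!: continuous_intros)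
  moreover have "path (p x)" "0 \<notin> path_image (p x)"
    using insert.prems(1)[of x] insert.prems(2)[of x] by (force simp: path_image_def)+
  ultimately show ?case using insert by (simp add: winding_number_mult)
qed

section \<open>Filling discs with nonvanishing values\<close>

text \<open>A loop of winding number 0 is contractible in the punctured plane, and a null-homotopic
  map on a circle extends to the disc with values in the same set.\<close>

lemma extend_nonvanishing_over_disc:
  fixes W :: "complex \<Rightarrow> complex"
  assumes r: "r > 0" and W: "continuous_on (sphere z r) W" "\<And>x. x \<in> sphere z r \<Longrightarrow> W x \<noteq> 0"
    and w0: "winding_number (W \<circ> circlepath z r) 0 = 0"
  obtains E where "continuous_on (cball z r) E" "\<And>x. x \<in> cball z r \<Longrightarrow> E x \<noteq> 0"
    "\<And>x. x \<in> sphere z r \<Longrightarrow> E x = W x"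
proof -
  let ?p = "W \<circ> circlepath z r"
  have pi: "path_image (circlepath z r) = sphere z r" using r by simp
  have "path ?p" by (intro path_continuous_image) (use pi W in auto)
  moreover have "0 \<notin> path_image ?p" using W(2) pi by (auto simp: path_image_compose)
  ultimately obtain a where "homotopic_loops (-{0}) ?p (\<lambda>t. a)"
    using w0 winding_number_homotopic_loops_null_eq by blast
  \<comment> \<open>The extension theorem is about maps on the unit circle, not about loops on
    \<open>{0..1}\<close>. Composing with the angle turns one into the other; \<open>g3\<close>
    below undoes this.\<close>
  let ?q = "?p \<circ> (\<lambda>z. (Arg2pi z / (2 * pi)))"
  have "homotopic_with_canon (\<lambda>h. True) (sphere 0 1) (-{0}) ?q (\<lambda>z. a)"
    using homotopic_loops_imp_homotopic_circlemaps[OF \<open>homotopic_loops _ _ _\<close>]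
    unfolding comp_def[of "\<lambda>t. a"] .
  then obtain g where g: "continuous_on (cball 0 1) g" "g ` (cball 0 1) \<subseteq> -{0}"
      "\<And>x. x \<in> sphere 0 1 \<Longrightarrow> g x = ?q x"
    using nullhomotopic_from_sphere_extension[of 0 1 "-{0}" ?q] by blast
  have g3: "g x = W (z + r * x)" if "norm x = 1" for x :: complex
  proof -
    have "of_real (norm x) * exp (\<i> * of_real (Arg2pi x)) = x"
      using Arg2pi_eq[of x] by (rule sym)
    then have e: "exp (\<i> * of_real (Arg2pi x)) = x" using that by simp
    have "?q x = W (z + r * exp (\<i> * of_real (Arg2pi x)))"
      by (simp add: circlepath ac_simps)
    then show ?thesis unfolding e using g(3)[of x] that by simp
  qed
  have ball: "(x - z) / r \<in> cball 0 1" if "x \<in> cball z r" for x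
    using r that by (simp add: norm_divide dist_norm norm_minus_commute)
  show ?thesis
  proof
    show "continuous_on (cball z r) (\<lambda>x. g ((x - z) / r))"
    proof (rule continuous_on_compose2[OF g(1)])
      show "continuous_on (cball z r) (\<lambda>x. (x - z) / r)"
        using r by (intro continuous_intros) auto
    qed (use ball in blast)
    show "g ((x - z) / r) \<noteq> 0" if "x \<in> cball z r" for x
      using ball[OF that] g(2) by blast
    show "g ((x - z) / r) = W x" if "x \<in> sphere z r" for x
      using g3[of "(x - z) / r"] r that by (simp add: norm_divide dist_norm norm_minus_commute)
  qed
qed

text \<open>The discs are filled one after the other. As they are disjoint, filling one leaves the
  values, and hence the winding numbers, on the other circles unchanged.\<close>

lemma extend_nonvanishing_over_discs:
  fixes W :: "complex \<Rightarrow> complex"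
  assumes "finite Z" "r > 0" "closed K"
    and "\<And>z. z \<in> Z \<Longrightarrow> cball z r \<subseteq> K"
    and "\<And>z w. z \<in> Z \<Longrightarrow> w \<in> Z \<Longrightarrow> z \<noteq> w \<Longrightarrow> cball z r \<inter> cball w r = {}"
    and "continuous_on (K - (\<Union>z\<in>Z. ball z r)) W"
    and "\<And>x. x \<in> K - (\<Union>z\<in>Z. ball z r) \<Longrightarrow> W x \<noteq> 0"
    and "\<And>z. z \<in> Z \<Longrightarrow> winding_number (W \<circ> circlepath z r) 0 = 0"
  shows "\<exists>W'. continuous_on K W' \<and> (\<forall>x\<in>K. W' x \<noteq> 0) \<and> (\<forall>x\<in>K - (\<Union>z\<in>Z. ball z r). W' x = W x)"
  using assms
proof (induction Z arbitrary: W rule: finite_induct)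
  case empty
  then show ?case by auto
next
  case (insert z Z)
  let ?A = "K - (\<Union>z\<in>insert z Z. ball z r)" and ?B = "K - (\<Union>z\<in>Z. ball z r)"
  have disj: "cball z r \<inter> cball w r = {}" if "w \<in> Z" for w
    using insert.prems(4)[of z w] insert.hyps that by auto
  have cb: "cball z r \<subseteq> ?B"
    using insert.prems(3)[of z] disj ball_subset_cball by fastforce
  have sA: "sphere z r \<subseteq> ?A" using cb by (auto simp: subset_iff)
  have "continuous_on (sphere z r) W"
    using insert.prems(5) sA continuous_on_subset by blast
  moreover have "W x \<noteq> 0" if "x \<in> sphere z r" for x using insert.prems(6) sA that by blast
  ultimately obtain E where E: "continuous_on (cball z r) E" "\<And>x. x \<in> cball z r \<Longrightarrow> E x \<noteq> 0"
    "\<And>x. x \<in> sphere z r \<Longrightarrow> E x = W x"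
    using extend_nonvanishing_over_disc[OF \<open>r > 0\<close>, of z W] insert.prems(7)[of z] by auto
  \<comment> \<open>The two pieces overlap only on the circle, where \<open>E\<close> and
    \<open>W\<close> agree, and both are closed; so they paste to a continuous function.\<close>
  define W1 where "W1 = (\<lambda>x. if x \<in> cball z r then E x else W x)"
  have BA: "?B = cball z r \<union> ?A" using cb by (auto simp: subset_iff)
  have "closed ?A" using \<open>closed K\<close> by (intro closed_Diff open_UN) auto
  then have "continuous_on ?B W1"
    unfolding BA W1_def using E insert.prems(5) by (intro continuous_on_cases) auto
  moreover have "W1 x \<noteq> 0" if "x \<in> ?B" for x
    using that BA E(2) insert.prems(6)[of x] by (auto simp: W1_def)
  moreover have "winding_number (W1 \<circ> circlepath w r) 0 = 0" if w: "w \<in> Z" for w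
  proof -
    have "winding_number (W1 \<circ> circlepath w r) 0 = winding_number (W \<circ> circlepath w r) 0"
    proof (intro winding_number_cong)
      fix t :: real assume t: "0 \<le> t" "t \<le> 1"
      then have "circlepath w r t \<in> path_image (circlepath w r)" by (auto simp: path_image_def)
      then have "circlepath w r t \<in> cball w r" using \<open>r > 0\<close> by simp
      then show "(W1 \<circ> circlepath w r) t = (W \<circ> circlepath w r) t"
        using disj[OF w] by (auto simp: W1_def)
    qed
    then show ?thesis using insert.prems(7) w by simp
  qed
  ultimately have "\<exists>W'. continuous_on K W' \<and> (\<forall>x\<in>K. W' x \<noteq> 0) \<and> (\<forall>x\<in>?B. W' x = W1 x)"
    using insert.prems(1-4) by (intro insert.IH) (auto simp: o_def)
  then obtain W' where W': "continuous_on K W'" "\<forall>x\<in>K. W' x \<noteq> 0" "\<forall>x\<in>?B. W' x = W1 x"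
    by blast
  moreover have "W' x = W x" if "x \<in> ?A" for x
    using that W'(3) E(3)[of x] by (auto simp: W1_def)
  ultimately show ?case by blast
qed

section \<open>Indices and the argument principle\<close>

text \<open>Concentric circles are homotopic in the punctured disc, where \<open>V\<close> has no
  zeros, so the winding number is the same for all radii below \<open>e\<close>. As the filter
  \<open>at_right 0\<close> is nontrivial, only this value can be the one chosen in
  \<open>zero_index\<close>.\<close>

lemma zero_index_eq_winding_number:
  assumes V: "continuous_on (ball z e - {z}) V" "\<And>x. x \<in> ball z e - {z} \<Longrightarrow> V x \<noteq> 0"
    and r: "0 < r" "r < e"
  shows "zero_index V z = winding_number (V \<circ> circlepath z r) 0"
proof -
  have eq: "winding_number (V \<circ> circlepath z s) 0 = winding_number (V \<circ> circlepath z r) 0"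
    if s: "0 < s" "s < e" for s
  proof (rule winding_number_homotopic_loops, rule homotopic_loops_continuous_image)
    show "homotopic_loops (ball z e - {z}) (circlepath z s) (circlepath z r)"
    proof (rule homotopic_loops_linear)
      fix t x :: real
      let ?u = "exp (2 * of_real pi * \<i> * of_real t)"
      have u: "norm ?u = 1" using norm_exp_i_times[of "2 * pi * t"] by (simp add: ac_simps)
      show "closed_segment (circlepath z s t) (circlepath z r t) \<subseteq> ball z e - {z}"
      proof
        fix w assume "w \<in> closed_segment (circlepath z s t) (circlepath z r t)"
        then obtain a where a: "0 \<le> a" "a \<le> 1"
          and w: "w = (1 - a) *\<^sub>R (z + s * ?u) + a *\<^sub>R (z + r * ?u)"
          by (auto simp: closed_segment_def circlepath)
        define b where "b = (1 - a) * s + a * r"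
        have "w - z = of_real b * ?u"
          unfolding w b_def by (simp add: scaleR_conv_of_real algebra_simps)
        then have d: "norm (w - z) = \<bar>b\<bar>" using u by (simp add: norm_mult)
        have "b > 0" unfolding b_def using a r s
          by (cases "a = 0") (auto intro!: add_nonneg_pos mult_nonneg_nonneg)
        moreover have "b < e" unfolding b_def using a r s by (intro convex_bound_lt) auto
        ultimately show "w \<in> ball z e - {z}" using d by (auto simp: dist_norm norm_minus_commute)
      qed
    qed auto
    show "continuous_on (ball z e - {z}) V" by fact
    show "V \<in> ball z e - {z} \<rightarrow> - {0}" using V(2) by auto
  qed
  have ev: "\<forall>\<^sub>F s in at_right 0. winding_number (V \<circ> circlepath z s) 0 = winding_number (V \<circ> circlepath z r) 0"
    unfolding eventually_at_right_field using eq r order_less_trans[OF r] by metis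
  show ?thesis unfolding zero_index_def
  proof (rule some_equality, rule ev)
    fix k assume "\<forall>\<^sub>F s in at_right 0. winding_number (V \<circ> circlepath z s) 0 = k"
    with ev have "\<forall>\<^sub>F s in at_right (0::real). k = winding_number (V \<circ> circlepath z r) 0"
      by eventually_elim simp
    then show "k = winding_number (V \<circ> circlepath z r) 0" by simp
  qed
qed

text \<open>This is the argument principle with indices in place of orders of zeros. The closed path
  \<open>g\<close> need not be simple, so its winding numbers enter as weights.\<close>

theorem winding_number_eq_sum_zero_index:
  assumes K: "compact K" "connected (- K)" and V: "continuous_on K V"
    and Z: "finite Z" "Z \<subseteq> interior K" "\<And>x. x \<in> K - Z \<Longrightarrow> V x \<noteq> 0"
    and g: "path g" "path_image g \<subseteq> K - Z" "pathfinish g = pathstart g"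
  shows "winding_number (V \<circ> g) 0 = (\<Sum>z\<in>Z. zero_index V z * winding_number g z)"
proof -
  have "\<exists>e>0. cball z e \<subseteq> interior K - path_image g - (Z - {z})" if z: "z \<in> Z" for z
  proof -
    have "open (interior K - path_image g - (Z - {z}))"
      using g(1) Z(1) by (intro open_Diff closed_path_image finite_imp_closed) auto
    moreover have "z \<in> interior K - path_image g - (Z - {z})" using z Z(2) g(2) by auto
    ultimately show ?thesis using open_contains_cball by blast
  qed
  then obtain e where e: "\<And>z. z \<in> Z \<Longrightarrow> e z > (0::real)"
    "\<And>z. z \<in> Z \<Longrightarrow> cball z (e z) \<subseteq> interior K - path_image g - (Z - {z})"
    by metis
  \<comment> \<open>With a third of the smallest \<open>e z\<close>, two discs of radius
    \<open>r\<close> around different zeros cannot meet, since then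
    \<open>dist z w \<le> 2 * r < e z\<close>. The entry 1 covers an empty \<open>Z\<close>.\<close>
  define r where "r = Min (insert 1 (e ` Z)) / 3"
  have r: "r > 0" unfolding r_def using e(1) Z(1) by auto
  have re: "3 * r \<le> e z" if "z \<in> Z" for z unfolding r_def using Z(1) that by simp
  have cb: "cball z r \<subseteq> interior K - path_image g - (Z - {z})" if "z \<in> Z" for z
  proof -
    have "cball z r \<subseteq> cball z (e z)" using re[OF that] r by (intro subset_cball) linarith
    then show ?thesis using e(2)[OF that] by blast
  qed
  have disj: "cball z r \<inter> cball w r = {}" if "z \<in> Z" "w \<in> Z" "z \<noteq> w" for z w
  proof (rule ccontr)
    assume "cball z r \<inter> cball w r \<noteq> {}"
    then obtain x where "dist z x \<le> r" "dist w x \<le> r" by auto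
    then have "dist z w \<le> e z" using re[OF that(1)] r dist_triangle2[of z w x] by linarith
    then show False using e(2)[OF that(1)] that by auto
  qed
  have KA: "cball z r \<subseteq> K" if "z \<in> Z" for z using cb[OF that] interior_subset by blast
  have zi: "zero_index V z = winding_number (V \<circ> circlepath z r) 0" if "z \<in> Z" for z
  proof (rule zero_index_eq_winding_number[where e = "e z"])
    have sub: "ball z (e z) - {z} \<subseteq> K - Z" using e(2)[OF that] interior_subset ball_subset_cball by blast
    show "continuous_on (ball z (e z) - {z}) V"
      using V sub continuous_on_subset by blast
    show "V x \<noteq> 0" if "x \<in> ball z (e z) - {z}" for x using Z(3) sub that by blast
  qed (use r re[OF that] in auto)
  have sph: "path_image (circlepath z r) \<subseteq> K - Z" if "z \<in> Z" for z
    using cb[OF that] r interior_subset[of K] by (auto simp: subset_iff)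
  have Vp: "path (V \<circ> p)" "0 \<notin> path_image (V \<circ> p)" if "path p" "path_image p \<subseteq> K - Z" for p
    using that V Z(3) by (auto intro!: path_continuous_image simp: path_image_compose intro: continuous_on_subset)
  \<comment> \<open>The index is a complex number by definition; being the winding number of a
    closed loop, it is an integer and can serve as an exponent.\<close>
  have "\<exists>k. zero_index V z = of_int k" if "z \<in> Z" for z
    using Vp[OF _ sph[OF that]] that zi integer_winding_number[of "V \<circ> circlepath z r" 0]
    by (auto simp: Ints_def pathfinish_compose pathstart_compose)
  then obtain k where k: "\<And>z. z \<in> Z \<Longrightarrow> zero_index V z = of_int (k z)" by metis
  define W where "W x = V x * (\<Prod>z\<in>Z. (x - z) powi (- k z))" for x
  have W_wind: "winding_number (W \<circ> p) 0
      = winding_number (V \<circ> p) 0 - (\<Sum>z\<in>Z. of_int (k z) * winding_number p z)"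
    if p: "path p" "path_image p \<subseteq> K - Z" for p
  proof -
    have pz: "path (\<lambda>t. p t - z)" for z using p(1) unfolding path_def by (intro continuous_intros)
    have p0: "0 \<notin> path_image (\<lambda>t. p t - z)" if "z \<in> Z" for z using p(2) that by (auto simp: path_image_def)
    have pZ: "p t \<notin> Z" if "t \<in> {0..1}" for t
      using p(2) that unfolding path_image_def by blast
    have q: "path (\<lambda>t. \<Prod>z\<in>Z. (p t - z) powi (- k z))"
        "0 \<notin> path_image (\<lambda>t. \<Prod>z\<in>Z. (p t - z) powi (- k z))"
    proof -
      show "path (\<lambda>t. \<Prod>z\<in>Z. (p t - z) powi (- k z))"
        using path_powi(1)[OF pz p0] unfolding path_def by (intro continuous_on_prod) auto
      show "0 \<notin> path_image (\<lambda>t. \<Prod>z\<in>Z. (p t - z) powi (- k z))"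
        using p(2) Z(1) by (auto simp: path_image_def)
    qed
    have "winding_number (W \<circ> p) 0 = winding_number (\<lambda>t. (V \<circ> p) t * (\<Prod>z\<in>Z. (p t - z) powi (- k z))) 0"
      by (simp add: W_def o_def)
    also have "\<dots> = winding_number (V \<circ> p) 0 + winding_number (\<lambda>t. \<Prod>z\<in>Z. (p t - z) powi (- k z)) 0"
      by (rule winding_number_mult[OF Vp[OF p] q])
    also have "winding_number (\<lambda>t. \<Prod>z\<in>Z. (p t - z) powi (- k z)) 0
        = (\<Sum>z\<in>Z. winding_number (\<lambda>t. (p t - z) powi (- k z)) 0)"
      using path_powi(1)[OF pz p0] pZ by (intro winding_number_prod Z(1)) auto
    also have "\<dots> = (\<Sum>z\<in>Z. - of_int (k z) * winding_number p z)"
    proof (intro sum.cong refl)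
      fix z assume "z \<in> Z"
      have "winding_number (\<lambda>t. (p t - z) powi (- k z)) 0
          = of_int (- k z) * winding_number (\<lambda>t. p t - z) 0"
        by (rule winding_number_powi[OF pz p0[OF \<open>z \<in> Z\<close>]])
      then show "winding_number (\<lambda>t. (p t - z) powi (- k z)) 0 = - of_int (k z) * winding_number p z"
        using winding_number_offset[of p z] by simp
    qed
    finally show ?thesis by (simp add: sum_negf o_def)
  qed
  \<comment> \<open>The circle winds once around \<open>w\<close> and not at all around the other
    zeros, so just the index \<open>k w\<close> is subtracted from the winding number of
    \<open>V\<close>.\<close>
  have W_circ: "winding_number (W \<circ> circlepath w r) 0 = 0" if w: "w \<in> Z" for w
  proof -
    have *: "winding_number (circlepath w r) z = (if z = w then 1 else 0)" if "z \<in> Z" for z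
    proof (cases "z = w")
      case True
      then show ?thesis using r winding_number_circlepath_centre by simp
    next
      case False
      then have "z \<notin> cball w r" using cb[OF w] that by auto
      moreover have "path_image (circlepath w r) \<subseteq> cball w r" using r by auto
      ultimately have "winding_number (circlepath w r) z = 0"
        by (intro winding_number_zero_outside[of _ "cball w r"]) auto
      with False show ?thesis by simp
    qed
    have "(\<Sum>z\<in>Z. of_int (k z) * winding_number (circlepath w r) z)
        = (\<Sum>z\<in>Z. if z = w then of_int (k w) else 0)"
      by (intro sum.cong) (auto simp: *)
    also have "\<dots> = of_int (k w)" using Z(1) w by simp
    finally show ?thesis using W_wind[of "circlepath w r"] sph[OF w] zi[OF w] k[OF w] by simp
  qed
  let ?A = "K - (\<Union>z\<in>Z. ball z r)"
  have AZ: "?A \<subseteq> K - Z" using r by auto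
  have "continuous_on ?A W"
    unfolding W_def using AZ
    by (intro continuous_on_mult continuous_on_prod continuous_on_power_int continuous_intros
        continuous_on_subset[OF V]) auto
  moreover have "W x \<noteq> 0" if "x \<in> ?A" for x
    using that AZ Z(1) Z(3)[of x] by (auto simp: W_def)
  ultimately obtain W' where W': "continuous_on K W'" "\<forall>x\<in>K. W' x \<noteq> 0" "\<forall>x\<in>?A. W' x = W x"
    using extend_nonvanishing_over_discs[OF Z(1) r compact_imp_closed[OF K(1)] KA disj _ _ W_circ]
    by blast
  \<comment> \<open>A compact plane set is Borsukian iff its complement is connected, and on such a
    set every nonvanishing continuous function has a continuous logarithm.\<close>
  have "Borsukian K" using K by (simp add: Borsukian_separation_compact)
  then obtain h where h: "continuous_on K h" "\<And>x. x \<in> K \<Longrightarrow> W' x = exp (h x)"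
    using W'(1,2) unfolding Borsukian_continuous_logarithm by blast
  have gA: "g t \<in> ?A" if "0 \<le> t" "t \<le> 1" for t
  proof -
    have "g t \<in> path_image g" using that by (auto simp: path_image_def)
    then show ?thesis using g(2) cb ball_subset_cball by fastforce
  qed
  \<comment> \<open>The logarithm \<open>h\<close> returns to its initial value along the closed
    path \<open>g\<close>, hence \<open>W\<close> does not wind along \<open>g\<close>.\<close>
  have "path (h \<circ> g)"
    using g h by (intro path_continuous_image) (auto intro: continuous_on_subset)
  then have "winding_number (exp \<circ> (h \<circ> g)) 0 = 0"
    using g(3) by (simp add: winding_number_compose_exp pathfinish_compose pathstart_compose)
  also have "winding_number (exp \<circ> (h \<circ> g)) 0 = winding_number (W \<circ> g) 0"
    using gA W'(3) h(2) by (intro winding_number_cong) auto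
  finally show ?thesis using W_wind[OF g(1,2)] k by simp
qed

subsection \<open>The rotation number of a simple closed curve\<close>

text \<open>The curve is a periodic map on the whole line, so no parameter is an endpoint and
  neighbourhoods may reach across \<open>0\<close> and \<open>L\<close>. Its orientation is left
  open.\<close>

locale unit_speed_loop =
  fixes \<gamma> \<tau> :: "real \<Rightarrow> complex" and L :: real
  assumes L_pos: "L > 0"
    and deriv: "\<And>t. (\<gamma> has_vector_derivative \<tau> t) (at t)"
    and cont_\<tau>: "continuous_on UNIV \<tau>"
    and norm_\<tau> [simp]: "\<And>t. norm (\<tau> t) = 1"
    and periodic: "\<And>t. \<gamma> (t + L) = \<gamma> t"
    and simple: "inj_on \<gamma> {0..<L}"
begin

section \<open>Periodicity and simplicity of the curve\<close>

lemma cont_\<gamma>: "continuous_on A \<gamma>"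
  by (intro continuous_at_imp_continuous_on ballI has_vector_derivative_continuous[OF deriv])

lemma periodic_int: "\<gamma> (t + of_int k * L) = \<gamma> t"
proof (induction k rule: int_induct[where k = 0])
  case (step1 i)
  then show ?case using periodic[of "t + of_int i * L"] by (simp add: algebra_simps)
next
  case (step2 i)
  then show ?case using periodic[of "t + of_int (i - 1) * L"] by (simp add: algebra_simps)
qed simp

lemma periodic_\<tau>: "\<tau> (t + of_int k * L) = \<tau> t"
proof -
  have "((\<lambda>x. \<gamma> (x + of_int k * L)) has_vector_derivative 1 *\<^sub>R \<tau> (t + of_int k * L)) (at t)"
    by (rule vector_diff_chain_at[of "\<lambda>x. x + of_int k * L" 1 t \<gamma>, unfolded o_def])
      (auto intro!: derivative_eq_intros deriv simp flip: has_real_derivative_iff_has_vector_derivative)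
  then have "(\<gamma> has_vector_derivative \<tau> (t + of_int k * L)) (at t)"
    by (simp add: periodic_int)
  then show ?thesis using deriv vector_derivative_unique_at by blast
qed

lemma reduce_mod_period:
  obtains k :: int where "a \<le> t + of_int k * L" "t + of_int k * L < a + L"
proof
  let ?k = "- \<lfloor>(t - a) / L\<rfloor>"
  have "of_int \<lfloor>(t - a) / L\<rfloor> \<le> (t - a) / L" "(t - a) / L < of_int \<lfloor>(t - a) / L\<rfloor> + 1"
    by linarith+
  then have "of_int \<lfloor>(t - a) / L\<rfloor> * L \<le> t - a" "t - a < (of_int \<lfloor>(t - a) / L\<rfloor> + 1) * L"
    unfolding pos_le_divide_eq[OF L_pos] pos_divide_less_eq[OF L_pos] .
  then show "a \<le> t + of_int ?k * L" "t + of_int ?k * L < a + L"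
    by (simp_all add: algebra_simps)
qed

text \<open>Both parameters are shifted into \<open>{0..<L}\<close>, where they coincide; the two
  shifts are equal because the parameters differ by less than one period.\<close>

lemma inj_period:
  assumes "\<gamma> s = \<gamma> t" "s \<le> t" "t < s + L" shows "s = t"
proof -
  obtain j where j: "0 \<le> s + of_int j * L" "s + of_int j * L < 0 + L" using reduce_mod_period by blast
  obtain k where k: "0 \<le> t + of_int k * L" "t + of_int k * L < 0 + L" using reduce_mod_period by blast
  have "\<gamma> (s + of_int j * L) = \<gamma> (t + of_int k * L)" using assms(1) by (simp only: periodic_int)
  then have eq: "s + of_int j * L = t + of_int k * L"
    using simple j k by (auto dest!: inj_onD)
  then have "of_int (j - k) * L = t - s" by (simp add: algebra_simps)
  then have "0 \<le> of_int (j - k) * L" "of_int (j - k) * L < 1 * L" using assms by simp_all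
  then have "0 \<le> (of_int (j - k) :: real)" "(of_int (j - k) :: real) < 1"
    using L_pos by (simp_all only: zero_le_mult_iff mult_less_cancel_right) auto
  then have "j = k" by linarith
  then show ?thesis using eq by simp
qed

abbreviation "loop \<equiv> (\<lambda>t. \<gamma> (L * t))"
abbreviation "C \<equiv> \<gamma> ` {0..L}"

lemma range_\<gamma>: "\<gamma> t \<in> C"
proof -
  obtain k where k: "0 \<le> t + of_int k * L" "t + of_int k * L < 0 + L" using reduce_mod_period by blast
  then show ?thesis using periodic_int[of t k] by (intro image_eqI[of _ _ "t + of_int k * L"]) auto
qed

lemma path_image_loop: "path_image loop = C"
proof -
  have "(\<lambda>t. L * t) ` {0..1} = {0..L}"
    using L_pos image_mult_atLeastAtMost[of L 0 1] by simp
  then show ?thesis unfolding path_image_def by (metis image_image)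
qed

lemma path_loop: "path loop"
  unfolding path_def by (intro continuous_on_compose2[OF cont_\<gamma>[of UNIV]] continuous_intros) auto

lemma closed_loop: "pathfinish loop = pathstart loop"
  using periodic[of 0] by (simp add: pathfinish_def pathstart_def)

lemma simple_path_loop: "simple_path loop"
proof -
  have *: "x = y \<or> x = 0 \<and> y = 1" if "0 \<le> x" "x \<le> y" "y \<le> 1" "\<gamma> (L * x) = \<gamma> (L * y)" for x y
  proof (cases "L * y < L * x + L")
    case True
    then have "L * x = L * y" using that L_pos by (intro inj_period) auto
    then show ?thesis using L_pos by simp
  next
    case False
    then have "L * (y - x) \<ge> L * 1" by (simp add: algebra_simps)
    then have "y - x \<ge> 1" using L_pos by (simp only: mult_le_cancel_left_pos)
    then show ?thesis using that by auto
  qed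
  show ?thesis unfolding simple_path_def loop_free_def
  proof (intro conjI ballI impI path_loop)
    fix x y :: real assume "x \<in> {0..1}" "y \<in> {0..1}" "\<gamma> (L * x) = \<gamma> (L * y)"
    then show "x = y \<or> x = 0 \<and> y = 1 \<or> x = 1 \<and> y = 0"
      using *[of x y] *[of y x] by (metis atLeastAtMost_iff linear)
  qed
qed

section \<open>Parallel curves and the Umlaufsatz\<close>

lemma Re_\<tau>_mult_cnj: "Re (\<tau> s * cnj (\<tau> t)) = 1 - (norm (\<tau> s - \<tau> t))\<^sup>2 / 2"
proof -
  have "(norm (\<tau> s))\<^sup>2 = 1" "(norm (\<tau> t))\<^sup>2 = 1" by simp_all
  then show ?thesis unfolding cmod_power2 by (simp add: power2_eq_square field_simps)
qed

lemma Re_\<gamma>_deriv: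
  "((\<lambda>x. Re ((\<gamma> x - p) * cnj q)) has_real_derivative Re (\<tau> x * cnj q)) (at x)"
proof -
  have "((\<lambda>x. (\<gamma> x - p) * cnj q) has_vector_derivative (\<tau> x - 0) * cnj q) (at x)"
    by (intro derivative_intros deriv)
  from bounded_linear.has_vector_derivative[OF bounded_linear_Re this]
  show ?thesis by (simp add: has_real_derivative_iff_has_vector_derivative)
qed

text \<open>\<open>Re (x * cnj y)\<close> is the inner product of the plane. For \<open>s\<close>
  near \<open>t\<close> the tangents make an acute angle, so the component of
  \<open>\<gamma> s - \<gamma> t\<close> along \<open>\<tau> t\<close> is strictly increasing in
  \<open>s\<close> and vanishes only at \<open>s = t\<close>. Hence a short piece of the curve has
  no chord normal to it at \<open>t\<close>.\<close>

lemma locally_transversal: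
  obtains d where "0 < d" "d \<le> L"
    "\<And>s t. t \<in> {0..L} \<Longrightarrow> \<bar>s - t\<bar> < d \<Longrightarrow> s \<noteq> t \<Longrightarrow> Re ((\<gamma> s - \<gamma> t) * cnj (\<tau> t)) \<noteq> 0"
proof -
  \<comment> \<open>The interval holds all parameters at distance below \<open>d \<le> L\<close>
    from some \<open>t\<close> in \<open>{0..L}\<close>, which makes \<open>d\<close> uniform in
    \<open>t\<close>.\<close>
  have "uniformly_continuous_on {- L..2 * L} \<tau>"
    using cont_\<tau> by (intro compact_uniformly_continuous) (auto intro: continuous_on_subset)
  then obtain d0 where d0: "d0 > 0"
    "\<And>s t. s \<in> {- L..2 * L} \<Longrightarrow> t \<in> {- L..2 * L} \<Longrightarrow> dist s t < d0 \<Longrightarrow> dist (\<tau> s) (\<tau> t) < 1"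
    unfolding uniformly_continuous_on_def by (meson zero_less_one)
  define d where "d = min d0 L"
  have pos: "Re (\<tau> x * cnj (\<tau> t)) > 0" if "t \<in> {0..L}" "\<bar>x - t\<bar> < d" for x t
  proof -
    have "dist (\<tau> x) (\<tau> t) < 1"
      using that by (intro d0) (auto simp: d_def dist_real_def abs_if split: if_splits)
    then have "(norm (\<tau> x - \<tau> t))\<^sup>2 < 1" by (simp add: dist_norm abs_square_less_1)
    then show ?thesis unfolding Re_\<tau>_mult_cnj by simp
  qed
  show ?thesis
  proof
    show "0 < d" "d \<le> L" using d0 L_pos by (auto simp: d_def)
    fix s t assume st: "t \<in> {0..L}" "\<bar>s - t\<bar> < d" "s \<noteq> t"
    let ?f = "\<lambda>x. Re ((\<gamma> x - \<gamma> t) * cnj (\<tau> t))"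
    have inc: "?f a < ?f b" if "a < b" "\<bar>a - t\<bar> < d" "\<bar>b - t\<bar> < d" for a b
    proof (rule DERIV_pos_imp_increasing[OF that(1)])
      fix x assume "a \<le> x" "x \<le> b"
      then have "\<bar>x - t\<bar> < d" using that by linarith
      with pos[OF st(1)] Re_\<gamma>_deriv
      show "\<exists>y. ((\<lambda>x. ?f x) has_real_derivative y) (at x) \<and> 0 < y" by blast
    qed
    show "?f s \<noteq> 0"
      using inc[of s t] inc[of t s] st \<open>0 < d\<close> by (cases "s < t") auto
  qed
qed

text \<open>If the normal at \<open>t\<close> meets the curve again at height \<open>h\<close>,
  there is a chord of length \<open>\<bar>h\<bar>\<close> normal to the curve at \<open>t\<close>.
  Nearby parameters are excluded by transversality, all others because their chords have lengths
  bounded away from 0.\<close>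

lemma normal_avoids_curve:
  obtains e where "0 < e" "\<And>t s h. h \<noteq> 0 \<Longrightarrow> \<bar>h\<bar> < e \<Longrightarrow> \<gamma> t + of_real h * (\<i> * \<tau> t) \<noteq> \<gamma> s"
proof -
  obtain d where d: "0 < d" "d \<le> L"
    "\<And>s t. t \<in> {0..L} \<Longrightarrow> \<bar>s - t\<bar> < d \<Longrightarrow> s \<noteq> t \<Longrightarrow> Re ((\<gamma> s - \<gamma> t) * cnj (\<tau> t)) \<noteq> 0"
    using locally_transversal by blast
  \<comment> \<open>These are the chords between parameters at distance at least \<open>d\<close>
    modulo the period. They form a compact set without 0, as the curve is simple.\<close>
  define K where "K = (\<lambda>(t, u). \<gamma> (t + u) - \<gamma> t) ` ({0..L} \<times> {d..L - d})"
  have "compact K" unfolding K_def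
    by (intro compact_continuous_image compact_Times compact_Icc)
      (auto simp: case_prod_unfold intro!: continuous_intros continuous_on_compose2[OF cont_\<gamma>[of UNIV]])
  moreover have "0 \<notin> K"
  proof
    assume "0 \<in> K"
    then obtain t u where "d \<le> u" "u \<le> L - d" "\<gamma> (t + u) = \<gamma> t" unfolding K_def by auto
    with inj_period[OF sym, of "t + u" t] d(1) show False by auto
  qed
  ultimately obtain m where m: "m > 0" "\<And>x. x \<in> K \<Longrightarrow> m \<le> dist 0 x"
    using separate_point_closed[of K 0] compact_imp_closed by blast
  show ?thesis
  proof
    show "m > 0" by fact
    fix t s h :: real assume h: "h \<noteq> 0" "\<bar>h\<bar> < m"
    show "\<gamma> t + of_real h * (\<i> * \<tau> t) \<noteq> \<gamma> s"
    proof
      assume eq: "\<gamma> t + of_real h * (\<i> * \<tau> t) = \<gamma> s"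
      obtain j where j: "0 \<le> t + of_int j * L" "t + of_int j * L < 0 + L"
        using reduce_mod_period by blast
      define t' where "t' = t + of_int j * L"
      obtain k where k: "t' \<le> s + of_int k * L" "s + of_int k * L < t' + L"
        using reduce_mod_period by blast
      define s' where "s' = s + of_int k * L"
      have t': "t' \<in> {0..L}" using j by (simp add: t'_def)
      have eq': "\<gamma> s' - \<gamma> t' = of_real h * (\<i> * \<tau> t')"
        unfolding s'_def t'_def periodic_int periodic_\<tau> eq[symmetric] by simp
      have \<tau>2: "\<tau> t' * cnj (\<tau> t') = 1" by (simp add: complex_norm_square[symmetric])
      have "(\<gamma> s' - \<gamma> t') * cnj (\<tau> t') = of_real h * \<i> * (\<tau> t' * cnj (\<tau> t'))"
        unfolding eq' by (simp add: ac_simps)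
      then have Re0: "Re ((\<gamma> s' - \<gamma> t') * cnj (\<tau> t')) = 0" unfolding \<tau>2 by simp
      have nz: "\<gamma> s' \<noteq> \<gamma> t'"
      proof
        assume "\<gamma> s' = \<gamma> t'"
        then have "norm (of_real h * (\<i> * \<tau> t')) = 0" using eq' by simp
        then show False using h by (simp add: norm_mult)
      qed
      \<comment> \<open>In the last case the parameter \<open>s' - L\<close> of the same point lies
        less than \<open>d\<close> below \<open>t'\<close>.\<close>
      consider "s' - t' < d" | "s' - t' \<in> {d..L - d}" | "s' - t' > L - d" by fastforce
      then show False
      proof cases
        case 1
        then show ?thesis using d(3)[OF t', of s'] Re0 nz k(1) by (auto simp: s'_def)
      next
        case 2
        then have "\<gamma> s' - \<gamma> t' \<in> K" unfolding K_def using t'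
          by (intro image_eqI[of _ _ "(t', s' - t')"]) auto
        from m(2)[OF this] have "m \<le> norm (of_real h * (\<i> * \<tau> t'))" unfolding eq' by simp
        then show ?thesis using h by (simp add: norm_mult)
      next
        case 3
        have "\<gamma> (s' - L) = \<gamma> s'" using periodic[of "s' - L"] by simp
        then show ?thesis using d(3)[OF t', of "s' - L"] Re0 nz k(2) 3 by (auto simp: s'_def)
      qed
    qed
  qed
qed

text \<open>One inner point close to the curve decides on which side the inside lies: it is on the
  normal at the nearest curve point, at some small height. All points at small heights of the same
  sign form a connected set missing the curve, so they are inside too.\<close>

lemma parallel_curve_inside:
  obtains h where "h \<noteq> 0" "\<And>t. \<gamma> t + of_real h * (\<i> * \<tau> t) \<in> inside C"
proof -
  obtain e where e: "0 < e" "\<And>t s h. h \<noteq> 0 \<Longrightarrow> \<bar>h\<bar> < e \<Longrightarrow> \<gamma> t + of_real h * (\<i> * \<tau> t) \<noteq> \<gamma> s"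
    using normal_avoids_curve by blast
  have fr: "frontier (inside C) = C"
    using Jordan_inside_outside[OF simple_path_loop closed_loop] by (simp add: path_image_loop)
  then have "\<gamma> 0 \<in> closure (inside C)" using range_\<gamma>[of 0] by (auto simp: frontier_def)
  then obtain z where z: "z \<in> inside C" "dist z (\<gamma> 0) < e"
    using e(1) closure_approachable by blast
  have "closed C" "C \<noteq> {}"
    using L_pos by (auto intro!: compact_imp_closed compact_continuous_image cont_\<gamma>)
  then obtain p where p: "p \<in> C" "\<And>q. q \<in> C \<Longrightarrow> dist z p \<le> dist z q"
    using distance_attains_inf[of C z] by metis
  obtain s where s: "p = \<gamma> s" using p(1) by blast
  have near: "dist z (\<gamma> s) \<le> dist z (\<gamma> x)" for x using p(2) range_\<gamma> s by blast
  \<comment> \<open>\<open>\<gamma> s\<close> is a point of the curve nearest to \<open>z\<close>, so \<open>z\<close> lies on the normal line at \<open>s\<close>.\<close>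
  define u where "u = (z - \<gamma> s) * cnj (\<tau> s)"
  have "((\<lambda>x. Re ((\<gamma> x - z) * cnj (\<gamma> x - z))) has_real_derivative
      2 * Re ((\<gamma> s - z) * cnj (\<tau> s))) (at s)"
  proof -
    have "((\<lambda>x. cnj (\<gamma> x - z)) has_vector_derivative cnj (\<tau> s - 0)) (at s)"
      by (intro has_vector_derivative_cnj derivative_intros deriv)
    then have "((\<lambda>x. (\<gamma> x - z) * cnj (\<gamma> x - z)) has_vector_derivative
        (\<gamma> s - z) * cnj (\<tau> s - 0) + (\<tau> s - 0) * cnj (\<gamma> s - z)) (at s)"
      by (intro has_vector_derivative_mult derivative_intros deriv)
    from bounded_linear.has_vector_derivative[OF bounded_linear_Re this]
    show ?thesis by (simp add: has_real_derivative_iff_has_vector_derivative algebra_simps)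
  qed
  then have "2 * Re ((\<gamma> s - z) * cnj (\<tau> s)) = 0"
  proof (rule DERIV_local_min[where d = 1])
    show "\<forall>y. \<bar>s - y\<bar> < 1 \<longrightarrow> Re ((\<gamma> s - z) * cnj (\<gamma> s - z)) \<le> Re ((\<gamma> y - z) * cnj (\<gamma> y - z))"
    proof -
      have "Re (w * cnj w) = (norm w)\<^sup>2" for w by (metis complex_norm_square Re_complex_of_real)
      then show ?thesis using near by (simp only: power_mono dist_norm norm_minus_commute norm_ge_zero simp_thms)
    qed
  qed auto
  then have "Re u = 0" by (simp add: u_def algebra_simps)
  then have u: "u = of_real (Im u) * \<i>" by (simp add: complex_eq_iff)
  have "\<tau> s * cnj (\<tau> s) = 1" by (simp add: complex_norm_square[symmetric])
  then have "z - \<gamma> s = u * \<tau> s" unfolding u_def by (simp add: ac_simps)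
  then have zu: "z = \<gamma> s + of_real (Im u) * (\<i> * \<tau> s)" using u by (simp add: algebra_simps)
  have "z \<notin> C" using z(1) inside_no_overlap by blast
  then have Im: "Im u \<noteq> 0" using zu range_\<gamma>[of s] by auto
  have "dist z (\<gamma> s) = \<bar>Im u\<bar>" unfolding dist_norm by (subst zu) (simp add: norm_mult)
  then have lt: "\<bar>Im u\<bar> < e" using near[of 0] z(2) by simp
  \<comment> \<open>The sign of the admissible heights depends on the orientation of the curve.
    Height 0 is left out, so \<open>T\<close> is a one-sided strip off the curve.\<close>
  define I where "I = {h::real. 0 < h * sgn (Im u) \<and> h * sgn (Im u) < e}"
  have I: "h \<noteq> 0" "\<bar>h\<bar> < e" if "h \<in> I" for h
    using that Im by (auto simp: I_def sgn_if split: if_splits)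
  have ImI: "Im u \<in> I" using Im lt by (auto simp: I_def sgn_if)
  have "I = (if Im u > 0 then {0<..<e} else {- e<..<0})"
    using Im by (auto simp: I_def sgn_if)
  then have "convex I" by simp
  define T where "T = (\<lambda>(t, h). \<gamma> t + of_real h * (\<i> * \<tau> t)) ` (UNIV \<times> I)"
  have "connected T" unfolding T_def
    using \<open>convex I\<close> by (intro connected_continuous_image connected_Times convex_connected)
      (auto simp: case_prod_unfold intro!: continuous_intros continuous_on_compose2[OF cont_\<gamma>[of UNIV]]
        continuous_on_compose2[OF cont_\<tau>])
  moreover have "T \<inter> frontier (inside C) = {}" unfolding fr T_def using e(2) I by fastforce
  moreover have "z \<in> T" unfolding T_def using zu ImI by (intro image_eqI[of _ _ "(s, Im u)"]) auto
  ultimately have "T \<subseteq> inside C" using connected_Int_frontier[of T "inside C"] z(1) by blast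
  then show ?thesis using ImI Im by (intro that[of "Im u"]) (auto simp: T_def)
qed

text \<open>Hopf's Umlaufsatz for both orientations at once: the two numbers are both 1 or both
  -1.\<close>

theorem winding_number_tangent:
  assumes z: "z \<in> inside C"
  shows "winding_number (\<lambda>t. \<tau> (L * t)) 0 = winding_number loop z"
proof -
  obtain h where h: "h \<noteq> 0" "\<And>t. \<gamma> t + of_real h * (\<i> * \<tau> t) \<in> inside C"
    using parallel_curve_inside by blast
  define \<nu> where "\<nu> t = \<gamma> (L * t) + of_real h * (\<i> * \<tau> (L * t))" for t
  have path_\<tau>: "path (\<lambda>t. \<tau> (L * t))"
    unfolding path_def by (intro continuous_on_compose2[OF cont_\<tau>] continuous_intros) auto
  have "path \<nu>" using path_loop path_\<tau> unfolding \<nu>_def path_def by (intro continuous_intros)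
  moreover have "\<gamma> L = \<gamma> 0" "\<tau> L = \<tau> 0" using periodic_int[of 0 1] periodic_\<tau>[of 0 1] by simp_all
  then have "pathfinish \<nu> = pathstart \<nu>" by (simp add: \<nu>_def pathfinish_def pathstart_def)
  moreover have "path_image \<nu> \<subseteq> inside C" using h(2) by (auto simp: \<nu>_def path_image_def)
  moreover have "simply_connected (inside C)"
    using simply_connected_inside_simple_path[OF simple_path_loop] by (simp add: path_image_loop)
  ultimately have "homotopic_loops (inside C) \<nu> (linepath z z)"
    using z unfolding simply_connected_eq_contractible_loop_any by blast
  then obtain k :: "real \<times> real \<Rightarrow> complex" where k: "continuous_on ({0..1} \<times> {0..1}) k" "k \<in> ({0..1} \<times> {0..1}) \<rightarrow> inside C"
    "\<And>x. x \<in> {0..1} \<Longrightarrow> k (0, x) = \<nu> x" "\<And>x. x \<in> {0..1} \<Longrightarrow> k (1, x) = z"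
    "\<And>u. u \<in> {0..1} \<Longrightarrow> k (u, 1) = k (u, 0)"
    unfolding homotopic_loops pathfinish_def pathstart_def o_def linepath_refl by blast
  \<comment> \<open>The contraction of the parallel curve to \<open>z\<close> stays inside, so it never meets the point of the
    curve at the same parameter.\<close>
  have "homotopic_loops (- {0}) (\<lambda>t. loop t - \<nu> t) (\<lambda>t. loop t - z)"
    unfolding homotopic_loops
  proof (intro exI[of _ "\<lambda>y. loop (snd y) - k y"] conjI ballI)
    show "continuous_on ({0..1} \<times> {0..1}) (\<lambda>y. loop (snd y) - k y)"
      by (intro continuous_intros continuous_on_compose2[OF cont_\<gamma>[of UNIV]] k(1)) auto
    have "loop (snd y) - k y \<noteq> 0" if "y \<in> {0..1} \<times> {0..1}" for y
    proof -
      have "k y \<in> inside C" using k(2) that by blast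
      then show ?thesis using range_\<gamma>[of "L * snd y"] inside_no_overlap[of C]
        by (metis disjoint_iff right_minus_eq)
    qed
    then show "(\<lambda>y. loop (snd y) - k y) \<in> {0..1} \<times> {0..1} \<rightarrow> - {0}" by auto
  qed (use k(3-5) \<open>\<gamma> L = \<gamma> 0\<close> in \<open>auto simp: pathfinish_def pathstart_def\<close>)
  from winding_number_homotopic_loops[OF this]
  \<comment> \<open>At the start of the homotopy the difference is a nonzero constant times the
    tangent, and the constant contributes no winding.\<close>
  have "winding_number loop z = winding_number (\<lambda>t. (- of_real h * \<i>) * \<tau> (L * t)) 0"
    by (subst winding_number_offset) (simp add: \<nu>_def algebra_simps)
  also have "\<dots> = winding_number (\<lambda>t. - of_real h * \<i>) 0 + winding_number (\<lambda>t. \<tau> (L * t)) 0"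
  proof (rule winding_number_mult[OF _ _ path_\<tau>])
    have "\<tau> t \<noteq> 0" for t using norm_\<tau>[of t] by fastforce
    then show "0 \<notin> path_image (\<lambda>t. \<tau> (L * t))" by (auto simp: path_image_def)
  qed (use h in \<open>auto simp: path_def path_image_def\<close>)
  also have "winding_number (\<lambda>t. - of_real h * \<i>) 0 = 0"
    using h(1) by (intro winding_number_constI) auto
  finally show ?thesis by simp
qed

end

subsection \<open>Iterated directional derivatives\<close>

lemma pd_eq_has_derivative:
  assumes "(f has_derivative D) (at z)"
  shows "pd v f z = D v"
proof -
  have "((\<lambda>t::real. z + of_real t * v) has_derivative (\<lambda>t. of_real t * v)) (at 0)"
    by (auto intro!: derivative_eq_intros)
  moreover have "(f has_derivative D) (at (z + of_real 0 * v))" using assms by simp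
  ultimately have "((\<lambda>t::real. f (z + of_real t * v)) has_derivative (\<lambda>t. D (of_real t * v))) (at 0)"
    by (rule has_derivative_compose)
  moreover have "D (of_real t * v) = t *\<^sub>R D v" for t
    using has_derivative_linear[OF assms] linear_scale scaleR_conv_of_real by metis
  ultimately show ?thesis unfolding pd_def
    by (intro vector_derivative_at) (simp add: has_vector_derivative_def)
qed

lemma pd_chain:
  assumes "f differentiable at (g t)" "(g has_vector_derivative v) (at t)"
  shows "((\<lambda>t. f (g t)) has_vector_derivative pd v f (g t)) (at t)"
proof -
  obtain D where D: "(f has_derivative D) (at (g t))" using assms differentiable_def by blast
  have "((\<lambda>t. f (g t)) has_derivative (\<lambda>x. D (x *\<^sub>R v))) (at t)"
    using assms(2) D unfolding has_vector_derivative_def by (rule has_derivative_compose)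
  moreover have "D (x *\<^sub>R v) = x *\<^sub>R D v" for x
    using has_derivative_linear[OF D] linear_scale by metis
  ultimately show ?thesis using pd_eq_has_derivative[OF D, of v]
    by (simp add: has_vector_derivative_def)
qed

lemma pd_has_vector_derivative_line:
  assumes "f differentiable at (p + of_real s * v)"
  shows "((\<lambda>t. f (p + of_real t * v)) has_vector_derivative pd v f (p + of_real s * v)) (at s)"
  using assms by (rule pd_chain) (auto intro!: derivative_eq_intros simp: has_vector_derivative_def scaleR_conv_of_real)

lemma pd_expand:
  assumes "f differentiable at z" "v = of_real a * u + of_real b * w"
  shows "pd v f z = of_real a * pd u f z + of_real b * pd w f z"
proof -
  obtain D where D: "(f has_derivative D) (at z)" using assms differentiable_def by blast
  have "D v = a *\<^sub>R D u + b *\<^sub>R D w"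
    using has_derivative_linear[OF D] unfolding assms(2)
    by (simp add: linear_add linear_scale flip: scaleR_conv_of_real)
  then show ?thesis unfolding pd_eq_has_derivative[OF D] by (simp add: scaleR_conv_of_real)
qed

lemma pd_linear:
  assumes "f differentiable at z" "g differentiable at z"
  shows "pd v (\<lambda>z. a * f z + b * g z) z = a * pd v f z + b * pd v g z"
proof -
  obtain D E where D: "(f has_derivative D) (at z)" and E: "(g has_derivative E) (at z)"
    using assms differentiable_def by blast
  have "((\<lambda>z. a * f z + b * g z) has_derivative (\<lambda>x. a * D x + b * E x)) (at z)"
    using D E by (auto intro!: derivative_eq_intros)
  from pd_eq_has_derivative[OF this] show ?thesis
    by (simp add: pd_eq_has_derivative[OF D] pd_eq_has_derivative[OF E])
qed

section \<open>Smooth functions on an open plane set\<close>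

locale open_plane_set =
  fixes U :: "complex set"
  assumes U_open: "open U"
begin

lemma pd_cong:
  assumes "z \<in> U" "\<And>w. w \<in> U \<Longrightarrow> f w = g w"
  shows "pd v f z = pd v g z"
  unfolding pd_def
proof (rule vector_derivative_cong_eq)
  have "open ((\<lambda>t::real. z + of_real t * v) -` U)"
    by (intro continuous_open_vimage continuous_intros U_open)
  moreover have "0 \<in> (\<lambda>t::real. z + of_real t * v) -` U" using assms(1) by simp
  ultimately have "\<forall>\<^sub>F t in nhds 0. t \<in> (\<lambda>t::real. z + of_real t * v) -` U"
    using eventually_nhds_in_open by blast
  then show "\<forall>\<^sub>F t in nhds 0. t \<in> UNIV \<longrightarrow> f (z + of_real t * v) = g (z + of_real t * v)"
    by eventually_elim (simp add: assms(2))
qed auto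

lemma fold_pd_cong:
  assumes "z \<in> U" "\<And>w. w \<in> U \<Longrightarrow> f w = g w"
  shows "fold pd vs f z = fold pd vs g z"
  using assms
proof (induction vs arbitrary: f g)
  case (Cons v vs)
  have "pd v f w = pd v g w" if "w \<in> U" for w by (rule pd_cong[OF that Cons.prems(2)])
  then show ?case unfolding fold_simps by (rule Cons.IH[OF Cons.prems(1)])
qed simp

lemma differentiable_on_cong:
  assumes "f differentiable_on U" "\<And>w. w \<in> U \<Longrightarrow> f w = g w"
  shows "g differentiable_on U"
  using assms differentiable_transform_within[of f _ U 1 g] unfolding differentiable_on_def by simp

lemma smooth_imp_differentiable: "smooth_on_C U f \<Longrightarrow> z \<in> U \<Longrightarrow> f differentiable at z"
  unfolding smooth_on_C_def
  by (drule spec[of _ "[]"]) (simp add: differentiable_on_eq_differentiable_at U_open)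

lemma smooth_imp_continuous_on: "smooth_on_C U f \<Longrightarrow> continuous_on U f"
  using smooth_imp_differentiable differentiable_imp_continuous_within
  by (metis continuous_at_imp_continuous_on)

lemma smooth_pd_basis: "smooth_on_C U f \<Longrightarrow> d \<in> {1, \<i>} \<Longrightarrow> smooth_on_C U (pd d f)"
  unfolding smooth_on_C_def
proof (intro allI impI)
  fix ds
  assume f: "\<forall>ds. set ds \<subseteq> {1, \<i>} \<longrightarrow> fold pd ds f differentiable_on U" and d: "d \<in> {1, \<i>}"
    and ds: "set ds \<subseteq> {1, \<i>}"
  then show "fold pd ds (pd d f) differentiable_on U" using f[rule_format, of "d # ds"] by simp
qed

lemma smooth_cong:
  assumes "smooth_on_C U f" "\<And>w. w \<in> U \<Longrightarrow> f w = g w"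
  shows "smooth_on_C U g"
  unfolding smooth_on_C_def
proof (intro allI impI)
  fix ds assume "set ds \<subseteq> {1, \<i>}"
  then have "fold pd ds f differentiable_on U" using assms(1) smooth_on_C_def by blast
  then show "fold pd ds g differentiable_on U"
    by (rule differentiable_on_cong) (rule fold_pd_cong[OF _ assms(2)])
qed

lemma smooth_linear:
  assumes "smooth_on_C U f" "smooth_on_C U g"
  shows "smooth_on_C U (\<lambda>z. a * f z + b * g z)"
  unfolding smooth_on_C_def
proof (intro allI impI)
  fix ds assume "set ds \<subseteq> {1, \<i>}"
  then show "fold pd ds (\<lambda>z. a * f z + b * g z) differentiable_on U"
    using assms
  proof (induction ds arbitrary: f g)
    case Nil
    have "f differentiable_on U" "g differentiable_on U"
      using Nil.prems smooth_imp_differentiable U_open differentiable_on_eq_differentiable_at by blast+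
    then show ?case by (simp add: differentiable_on_mult)
  next
    case (Cons d ds)
    have lin: "pd d (\<lambda>z. a * f z + b * g z) w = a * pd d f w + b * pd d g w" if "w \<in> U" for w
      using Cons.prems smooth_imp_differentiable that by (intro pd_linear) auto
    have eq: "fold pd (d # ds) (\<lambda>z. a * f z + b * g z) w
        = fold pd ds (\<lambda>z. a * pd d f z + b * pd d g z) w" if "w \<in> U" for w
      unfolding fold_simps by (rule fold_pd_cong[OF that lin])
    have "fold pd ds (\<lambda>z. a * pd d f z + b * pd d g z) differentiable_on U"
      using Cons.prems smooth_pd_basis by (intro Cons.IH) auto
    then show ?case by (rule differentiable_on_cong) (rule eq[symmetric])
  qed
qed

text \<open>Smoothness is defined through the directions \<open>1\<close> and \<open>\<i>\<close>
  alone; a derivative in any direction is a real combination of these two.\<close>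

lemma smooth_pd: assumes "smooth_on_C U f" shows "smooth_on_C U (pd v f)"
proof (rule smooth_cong)
  show "smooth_on_C U (\<lambda>z. of_real (Re v) * pd 1 f z + of_real (Im v) * pd \<i> f z)"
    using assms smooth_pd_basis by (intro smooth_linear) auto
  show "of_real (Re v) * pd 1 f w + of_real (Im v) * pd \<i> f w = pd v f w" if "w \<in> U" for w
    using smooth_imp_differentiable[OF assms that]
    by (intro pd_expand[symmetric]) (simp_all add: complex_eq mult.commute)
qed

lemma smooth_fold_pd: "smooth_on_C U f \<Longrightarrow> smooth_on_C U (fold pd vs f)"
  by (induction vs arbitrary: f) (simp_all add: smooth_pd)

lemma fold_pd_linear:
  assumes "smooth_on_C U f" "smooth_on_C U g" "z \<in> U"
  shows "fold pd vs (\<lambda>z. a * f z + b * g z) z = a * fold pd vs f z + b * fold pd vs g z"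
  using assms
proof (induction vs arbitrary: f g)
  case (Cons v vs)
  have "pd v (\<lambda>z. a * f z + b * g z) w = a * pd v f w + b * pd v g w" if "w \<in> U" for w
    using Cons.prems smooth_imp_differentiable that by (intro pd_linear) auto
  then have "fold pd (v # vs) (\<lambda>z. a * f z + b * g z) z
      = fold pd vs (\<lambda>z. a * pd v f z + b * pd v g z) z"
    unfolding fold_simps by (rule fold_pd_cong[OF \<open>z \<in> U\<close>])
  also have "\<dots> = a * fold pd vs (pd v f) z + b * fold pd vs (pd v g) z"
    using Cons.prems smooth_pd by (intro Cons.IH) auto
  finally show ?case by simp
qed simp

section \<open>Symmetry of mixed derivatives\<close>

text \<open>The mean value theorem is applied twice to the second difference over a parallelogram,
  first along \<open>v\<close>, then along \<open>w\<close>. As it needs real values, the function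
  is seen through a real functional \<open>\<psi>\<close>, later \<open>Re\<close> and
  \<open>Im\<close>.\<close>

lemma second_difference_mvt:
  fixes \<psi> :: "complex \<Rightarrow> real"
  assumes f: "smooth_on_C U f" and \<psi>: "bounded_linear \<psi>" and h: "h > 0"
    and sq: "\<And>s t. s \<in> {0..h} \<Longrightarrow> t \<in> {0..h} \<Longrightarrow> z + of_real s * v + of_real t * w \<in> U"
  obtains s t where "s \<in> {0..h}" "t \<in> {0..h}"
    "\<psi> (f (z + of_real h * v + of_real h * w)) - \<psi> (f (z + of_real h * v))
        - \<psi> (f (z + of_real h * w)) + \<psi> (f z)
      = h\<^sup>2 * \<psi> (pd w (pd v f) (z + of_real s * v + of_real t * w))"
proof -
  have D: "((\<lambda>x. \<psi> (g (p + of_real x * u))) has_real_derivative \<psi> (pd u g (p + of_real x * u))) (at x)"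
    if "smooth_on_C U g" "p + of_real x * u \<in> U" for g p u x
    using bounded_linear.has_vector_derivative[OF \<psi> pd_has_vector_derivative_line]
      smooth_imp_differentiable[OF that]
    by (simp add: has_real_derivative_iff_has_vector_derivative)
  let ?g = "\<lambda>x. \<psi> (f ((z + of_real h * w) + of_real x * v)) - \<psi> (f (z + of_real x * v))"
  have "\<exists>s>0. s < h \<and> ?g h - ?g 0 = (h - 0) *
      (\<psi> (pd v f ((z + of_real h * w) + of_real s * v)) - \<psi> (pd v f (z + of_real s * v)))"
  proof (intro MVT2 DERIV_diff D f h)
    fix x assume "0 \<le> x" "x \<le> h"
    then show "z + of_real h * w + of_real x * v \<in> U" "z + of_real x * v \<in> U"
      using sq[of x h] sq[of x 0] h by (simp_all add: ac_simps)
  qed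
  then obtain s where s: "0 < s" "s < h" and gs: "?g h - ?g 0 = h *
      (\<psi> (pd v f ((z + of_real h * w) + of_real s * v)) - \<psi> (pd v f (z + of_real s * v)))"
    by auto
  let ?k = "\<lambda>y. \<psi> (pd v f ((z + of_real s * v) + of_real y * w))"
  have "\<exists>t>0. t < h \<and> ?k h - ?k 0 = (h - 0) * \<psi> (pd w (pd v f) ((z + of_real s * v) + of_real t * w))"
    using s sq by (intro MVT2 D smooth_pd f h) auto
  then obtain t where t: "0 < t" "t < h"
    and kt: "?k h - ?k 0 = h * \<psi> (pd w (pd v f) ((z + of_real s * v) + of_real t * w))"
    by auto
  show ?thesis
  proof
    show "s \<in> {0..h}" "t \<in> {0..h}" using s t by auto
    have "?g h - ?g 0 = h * (?k h - ?k 0)" unfolding gs by (simp add: ac_simps)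
    then show "\<psi> (f (z + of_real h * v + of_real h * w)) - \<psi> (f (z + of_real h * v))
        - \<psi> (f (z + of_real h * w)) + \<psi> (f z)
      = h\<^sup>2 * \<psi> (pd w (pd v f) (z + of_real s * v + of_real t * w))"
      unfolding kt by (simp add: power2_eq_square algebra_simps)
  qed
qed

text \<open>The second difference is symmetric in \<open>v\<close> and \<open>w\<close>, so the two
  mixed derivatives agree at some pair of points of a small parallelogram. By continuity they agree
  at \<open>z\<close>.\<close>

lemma pd_commute_functional:
  fixes \<psi> :: "complex \<Rightarrow> real"
  assumes f: "smooth_on_C U f" and \<psi>: "bounded_linear \<psi>" and z: "z \<in> U"
  shows "\<psi> (pd v (pd w f) z) = \<psi> (pd w (pd v f) z)"
proof (rule ccontr)
  assume ne: "\<not> ?thesis"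
  \<comment> \<open>Half the supposed gap: two errors below \<open>e\<close> cannot bridge
    it.\<close>
  define e where "e = \<bar>\<psi> (pd v (pd w f) z) - \<psi> (pd w (pd v f) z)\<bar> / 2"
  have e: "e > 0" using ne by (simp add: e_def)
  have cont: "continuous_on U (\<lambda>x. \<psi> (pd a (pd b f) x))" for a b
    by (intro bounded_linear.continuous_on[OF \<psi>] smooth_imp_continuous_on smooth_pd f)
  have "\<exists>d>0. \<forall>x\<in>U. dist x z < d \<longrightarrow> dist (\<psi> (pd a (pd b f) x)) (\<psi> (pd a (pd b f) z)) < e" for a b
    using cont[of a b] e z unfolding continuous_on_iff by blast
  then obtain d1 d2 where d: "d1 > 0" "d2 > 0"
    "\<And>x. x \<in> U \<Longrightarrow> dist x z < d1 \<Longrightarrow> dist (\<psi> (pd v (pd w f) x)) (\<psi> (pd v (pd w f) z)) < e"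
    "\<And>x. x \<in> U \<Longrightarrow> dist x z < d2 \<Longrightarrow> dist (\<psi> (pd w (pd v f) x)) (\<psi> (pd w (pd v f) z)) < e"
    by metis
  obtain d0 where d0: "d0 > 0" "ball z d0 \<subseteq> U" using U_open z open_contains_ball by blast
  define d where "d = min d0 (min d1 d2)"
  \<comment> \<open>With this size the whole parallelogram stays within distance \<open>d\<close> of
    \<open>z\<close>; the 1 keeps the denominator positive if \<open>v\<close> and \<open>w\<close>
    are 0.\<close>
  define h where "h = d / (norm v + norm w + 1)"
  have "d > 0" using d d0 by (simp add: d_def)
  then have h: "h > 0" by (simp add: h_def add_nonneg_pos)
  have near: "dist (z + of_real s * v + of_real t * w) z < d" if "s \<in> {0..h}" "t \<in> {0..h}" for s t
  proof -
    have "norm (of_real s * v + of_real t * w) \<le> s * norm v + t * norm w"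
      using that by (intro norm_triangle_le) (simp add: norm_mult)
    also have "\<dots> \<le> h * norm v + h * norm w"
      using that by (intro add_mono mult_right_mono) auto
    also have "\<dots> < h * (norm v + norm w + 1)" using h by (simp add: algebra_simps)
    also have "\<dots> = d" using norm_ge_zero[of v] norm_ge_zero[of w] by (simp add: h_def add_nonneg_eq_0_iff)
    finally show ?thesis by (simp add: dist_norm add.assoc)
  qed
  have inU: "z + of_real s * v + of_real t * w \<in> U" if "s \<in> {0..h}" "t \<in> {0..h}" for s t
    using near[OF that] d0 by (auto simp: d_def dist_commute subset_iff)
  have inU': "z + of_real t * w + of_real s * v \<in> U" if "t \<in> {0..h}" "s \<in> {0..h}" for s t
    using inU[OF that(2,1)] by (simp add: ac_simps)
  obtain s t where st: "s \<in> {0..h}" "t \<in> {0..h}"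
    "\<psi> (f (z + of_real h * v + of_real h * w)) - \<psi> (f (z + of_real h * v))
        - \<psi> (f (z + of_real h * w)) + \<psi> (f z)
      = h\<^sup>2 * \<psi> (pd w (pd v f) (z + of_real s * v + of_real t * w))"
    using second_difference_mvt[OF f \<psi> h inU] by blast
  obtain t' s' where st': "t' \<in> {0..h}" "s' \<in> {0..h}"
    "\<psi> (f (z + of_real h * w + of_real h * v)) - \<psi> (f (z + of_real h * w))
        - \<psi> (f (z + of_real h * v)) + \<psi> (f z)
      = h\<^sup>2 * \<psi> (pd v (pd w f) (z + of_real t' * w + of_real s' * v))"
    using second_difference_mvt[OF f \<psi> h inU'] by blast
  have "h\<^sup>2 * \<psi> (pd w (pd v f) (z + of_real s * v + of_real t * w))
      = h\<^sup>2 * \<psi> (pd v (pd w f) (z + of_real t' * w + of_real s' * v))"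
    unfolding st(3)[symmetric] st'(3)[symmetric] by (simp add: ac_simps)
  then have eq: "\<psi> (pd w (pd v f) (z + of_real s * v + of_real t * w))
      = \<psi> (pd v (pd w f) (z + of_real t' * w + of_real s' * v))" using h by simp
  have "dist (\<psi> (pd w (pd v f) (z + of_real s * v + of_real t * w))) (\<psi> (pd w (pd v f) z)) < e"
    using near[OF st(1,2)] inU[OF st(1,2)] by (intro d(4)) (auto simp: d_def)
  moreover have "dist (\<psi> (pd v (pd w f) (z + of_real t' * w + of_real s' * v))) (\<psi> (pd v (pd w f) z)) < e"
    using near[OF st'(2,1)] inU'[OF st'(1,2)] by (intro d(3)) (auto simp: d_def ac_simps)
  ultimately have "dist (\<psi> (pd w (pd v f) z)) (\<psi> (pd v (pd w f) z)) < e + e"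
    unfolding eq by (metis add_strict_mono dist_triangle3 le_less_trans)
  then show False unfolding e_def dist_real_def by (simp add: abs_minus_commute)
qed

lemma pd_commute:
  assumes "smooth_on_C U f" "z \<in> U"
  shows "pd v (pd w f) z = pd w (pd v f) z"
  using pd_commute_functional[OF assms(1) bounded_linear_Re assms(2)]
    pd_commute_functional[OF assms(1) bounded_linear_Im assms(2)] by (simp add: complex_eq_iff)

lemma fold_pd_commute:
  assumes "smooth_on_C U f" "z \<in> U"
  shows "fold pd ws (pd v f) z = pd v (fold pd ws f) z"
  using assms
proof (induction ws arbitrary: f)
  case (Cons w ws)
  have "fold pd (w # ws) (pd v f) z = fold pd ws (pd v (pd w f)) z"
    unfolding fold_simps by (rule fold_pd_cong[OF Cons.prems(2) pd_commute[OF Cons.prems(1)]])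
  also have "\<dots> = pd v (fold pd ws (pd w f)) z"
    using Cons.IH[OF smooth_pd] Cons.prems by blast
  finally show ?case by simp
qed simp

section \<open>Real-valued functions and derivatives along lines\<close>

lemma pd_real:
  assumes "smooth_on_C U f" "\<And>w. w \<in> U \<Longrightarrow> Im (f w) = 0" "z \<in> U"
  shows "Im (pd v f z) = 0"
proof -
  have "(f \<circ> (\<lambda>t::real. z + of_real t * v) has_vector_derivative pd v f z) (at 0)"
    using pd_has_vector_derivative_line[of f z 0 v] smooth_imp_differentiable[OF assms(1,3)] by (simp add: o_def)
  then have "((\<lambda>t. of_real (Im (f (z + of_real t * v)))) has_vector_derivative complex_of_real (Im (pd v f z))) (at 0)"
    by (intro bounded_linear.has_vector_derivative[OF bounded_linear_of_real]
      bounded_linear.has_vector_derivative[OF bounded_linear_Im]) (simp add: o_def)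
  then have "pd v (\<lambda>w. of_real (Im (f w))) z = of_real (Im (pd v f z))"
    unfolding pd_def by (rule vector_derivative_at)
  moreover have "pd v (\<lambda>w. of_real (Im (f w))) z = pd v (\<lambda>w. 0) z"
    using assms by (intro pd_cong) auto
  moreover have "pd v (\<lambda>w. 0) z = 0" by (simp add: pd_def)
  ultimately show ?thesis by simp
qed

lemma funpow_pd_real:
  assumes "smooth_on_C U f" "\<And>w. w \<in> U \<Longrightarrow> Im (f w) = 0" "z \<in> U"
  shows "Im ((pd v ^^ m) f z) = 0"
  using assms
proof (induction m arbitrary: f)
  case (Suc m)
  then show ?case using pd_real smooth_pd unfolding funpow_Suc_right o_def by metis
qed simp

lemma fold_pd_replicate: "fold pd (replicate m v) f = (pd v ^^ m) f"
  by (induction m arbitrary: f) (simp_all add: funpow_swap1)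

lemma smooth_funpow_pd: "smooth_on_C U f \<Longrightarrow> smooth_on_C U ((pd v ^^ m) f)"
  unfolding fold_pd_replicate[symmetric] by (rule smooth_fold_pd)

text \<open>This translates the one-variable normal derivatives of the hypotheses into iterates of
  \<open>pd\<close>.\<close>

lemma funpow_deriv_line:
  fixes h :: "complex \<Rightarrow> real"
  assumes "smooth_on_C U (\<lambda>w. complex_of_real (h w))" "z + of_real s * v \<in> U"
  shows "(deriv ^^ j) (\<lambda>s. h (z + of_real s * v)) s
    = Re ((pd v ^^ j) (\<lambda>w. complex_of_real (h w)) (z + of_real s * v))"
  using assms(2)
proof (induction j arbitrary: s)
  case (Suc j)
  let ?f = "(pd v ^^ j) (\<lambda>w. complex_of_real (h w))"
  let ?S = "(\<lambda>s::real. z + of_real s * v) -` U"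
  have "open ?S" by (intro continuous_open_vimage continuous_intros U_open)
  have "((\<lambda>s. Re (?f (z + of_real s * v))) has_real_derivative Re (pd v ?f (z + of_real s * v))) (at s)"
    using bounded_linear.has_vector_derivative[OF bounded_linear_Re pd_has_vector_derivative_line]
      smooth_imp_differentiable[OF smooth_funpow_pd[OF assms(1)] Suc.prems]
    by (simp add: has_real_derivative_iff_has_vector_derivative)
  then have "((deriv ^^ j) (\<lambda>s. h (z + of_real s * v)) has_real_derivative
      Re (pd v ?f (z + of_real s * v))) (at s)"
    by (rule has_field_derivative_transform_within_open[OF _ \<open>open ?S\<close>]) (use Suc in auto)
  then show ?case using DERIV_imp_deriv by simp
qed simp

section \<open>Derivatives in a tangential and normal frame\<close>

text \<open>For smooth \<open>f\<close> it says that contracting the differential of order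
  \<open>m\<close>, a symmetric form, with \<open>\<tau>\<close> gives 0, so only the normal
  component counts. The case \<open>m = 0\<close> is vacuously true.\<close>

definition annihilates :: "nat \<Rightarrow> complex \<Rightarrow> (complex \<Rightarrow> complex) \<Rightarrow> complex \<Rightarrow> bool" where
  "annihilates m \<tau> f z \<longleftrightarrow> (\<forall>ws. length ws = m \<longrightarrow> \<tau> \<in> set ws \<longrightarrow> fold pd ws f z = 0)"

text \<open>By symmetry an occurrence of \<open>\<tau>\<close> can be moved outermost, where it
  differentiates along the curve.\<close>

lemma annihilatesI:
  assumes f: "smooth_on_C U f" and z: "z \<in> U"
    and out: "\<And>ws. length ws = m \<Longrightarrow> pd \<tau> (fold pd ws f) z = 0"
  shows "annihilates (Suc m) \<tau> f z"
  unfolding annihilates_def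
proof (intro allI impI)
  fix ws assume ws: "length ws = Suc m" "\<tau> \<in> set ws"
  obtain xs ys where xy: "ws = xs @ \<tau> # ys" using split_list[OF ws(2)] by blast
  have "fold pd ws f z = fold pd ys (pd \<tau> (fold pd xs f)) z" by (simp add: xy)
  also have "\<dots> = pd \<tau> (fold pd (xs @ ys) f) z"
    using fold_pd_commute[OF smooth_fold_pd[OF f] z] by simp
  also have "\<dots> = 0" using ws(1) by (intro out) (simp add: xy)
  finally show "fold pd ws f z = 0" .
qed

lemma annihilates_pd: "annihilates (Suc m) \<tau> f z \<Longrightarrow> annihilates m \<tau> (pd v f) z"
  unfolding annihilates_def
proof (intro allI impI)
  fix ws assume a: "\<forall>ws. length ws = Suc m \<longrightarrow> \<tau> \<in> set ws \<longrightarrow> fold pd ws f z = 0"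
    "length ws = m" "\<tau> \<in> set ws"
  then show "fold pd ws (pd v f) z = 0" using a(1)[rule_format, of "v # ws"] by simp
qed

text \<open>The first direction is split into its tangential and normal parts. The tangential term
  vanishes by annihilation, the normal one by induction, until only the pure normal derivative is
  left.\<close>

lemma fold_pd_eq_0_if_annihilates:
  assumes "smooth_on_C U f" "z \<in> U" "annihilates m \<tau> f z" "norm \<tau> = 1"
    and "(pd (\<i> * \<tau>) ^^ m) f z = 0" "length vs = m"
  shows "fold pd vs f z = 0"
  using assms
proof (induction m arbitrary: f vs)
  case (Suc m)
  obtain v ws where vs: "vs = v # ws" "length ws = m" using Suc.prems(6) by (cases vs) auto
  let ?a = "Re (v * cnj \<tau>)" and ?b = "Im (v * cnj \<tau>)"
  have "\<tau> * cnj \<tau> = 1" using Suc.prems(4) by (simp add: complex_norm_square[symmetric])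
  \<comment> \<open>The coordinates of \<open>v\<close> in the orthonormal frame
    \<open>\<tau>\<close>, \<open>\<i> * \<tau>\<close> are the real and imaginary parts of
    \<open>v * cnj \<tau>\<close>.\<close>
  then have "v = (v * cnj \<tau>) * \<tau>" by (simp add: ac_simps)
  also have "\<dots> = of_real ?a * \<tau> + of_real ?b * (\<i> * \<tau>)"
    by (subst (1) complex_eq[of "v * cnj \<tau>"]) (simp only: algebra_simps)
  finally have v: "v = of_real ?a * \<tau> + of_real ?b * (\<i> * \<tau>)" .
  have "fold pd vs f z = fold pd ws (\<lambda>w. of_real ?a * pd \<tau> f w + of_real ?b * pd (\<i> * \<tau>) f w) z"
    unfolding vs fold_Cons o_def
    using pd_expand[OF smooth_imp_differentiable[OF Suc.prems(1)] v] by (intro fold_pd_cong Suc.prems(2))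
  also have "\<dots> = of_real ?a * fold pd ws (pd \<tau> f) z + of_real ?b * fold pd ws (pd (\<i> * \<tau>) f) z"
    by (intro fold_pd_linear smooth_pd Suc.prems)
  also have "fold pd ws (pd \<tau> f) z = 0"
    using Suc.prems(3) vs(2) unfolding annihilates_def by (auto dest!: spec[of _ "\<tau> # ws"])
  also have "fold pd ws (pd (\<i> * \<tau>) f) z = 0"
  proof (rule Suc.IH[OF smooth_pd _ annihilates_pd])
    show "(pd (\<i> * \<tau>) ^^ m) (pd (\<i> * \<tau>) f) z = 0" using Suc.prems(5) by (simp add: funpow_swap1)
  qed (use Suc.prems vs(2) in auto)
  finally show ?case by simp
qed simp

lemma smooth_dbar: "smooth_on_C U f \<Longrightarrow> smooth_on_C U (dbar_op f)"
proof -
  assume "smooth_on_C U f"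
  then have "smooth_on_C U (\<lambda>z. 1 * pd 1 f z + \<i> * pd \<i> f z)" by (intro smooth_linear smooth_pd)
  then show ?thesis unfolding dbar_op_def[abs_def] by simp
qed

lemma smooth_funpow_dbar: "smooth_on_C U f \<Longrightarrow> smooth_on_C U ((dbar_op ^^ m) f)"
  by (induction m) (simp_all add: smooth_dbar)

text \<open>In the frame \<open>\<tau>\<close>, \<open>?\<nu>\<close> the operator is
  \<open>\<tau>\<close> times the tangential plus \<open>?\<nu>\<close> times the normal derivative.
  Each application loses its tangential term at \<open>z\<close> and contributes a factor
  \<open>?\<nu>\<close>.\<close>

lemma funpow_dbar_if_annihilates:
  assumes "smooth_on_C U f" "z \<in> U" "annihilates m \<tau> f z" "norm \<tau> = 1"
  shows "(dbar_op ^^ m) f z = (\<i> * \<tau>) ^ m * (pd (\<i> * \<tau>) ^^ m) f z"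
  using assms
proof (induction m arbitrary: f)
  case (Suc m)
  let ?\<nu> = "\<i> * \<tau>"
  have \<tau>: "(Re \<tau>)\<^sup>2 + (Im \<tau>)\<^sup>2 = 1" using Suc.prems(4) by (simp add: cmod_def)
  have dbar: "dbar_op f w = \<tau> * pd \<tau> f w + ?\<nu> * pd ?\<nu> f w" if "w \<in> U" for w
  proof -
    note E = pd_expand[OF smooth_imp_differentiable[OF Suc.prems(1) that]]
    have 1: "pd \<tau> f w = of_real (Re \<tau>) * pd 1 f w + of_real (Im \<tau>) * pd \<i> f w"
      by (rule E) (simp add: complex_eq_iff)
    have 2: "pd ?\<nu> f w = of_real (- Im \<tau>) * pd 1 f w + of_real (Re \<tau>) * pd \<i> f w"
      by (rule E) (simp add: complex_eq_iff)
    have "\<tau> * pd \<tau> f w + ?\<nu> * pd ?\<nu> f w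
        = \<tau> * cnj \<tau> * (pd 1 f w + \<i> * pd \<i> f w)"
      unfolding 1 2 by (simp add: complex_eq_iff algebra_simps)
    also have "\<tau> * cnj \<tau> = 1" using Suc.prems(4) by (simp add: complex_norm_square[symmetric])
    finally show ?thesis by (simp add: dbar_op_def)
  qed
  have fold_dbar: "fold pd ws (dbar_op f) z = \<tau> * fold pd ws (pd \<tau> f) z + ?\<nu> * fold pd ws (pd ?\<nu> f) z" for ws
    using fold_pd_cong[OF Suc.prems(2) dbar] fold_pd_linear smooth_pd Suc.prems(1,2) by simp
  have "annihilates m \<tau> (dbar_op f) z"
    using annihilates_pd[OF Suc.prems(3)] fold_dbar by (simp add: annihilates_def)
  then have "(dbar_op ^^ m) (dbar_op f) z = ?\<nu> ^ m * (pd ?\<nu> ^^ m) (dbar_op f) z"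
    using Suc.prems smooth_dbar by (intro Suc.IH) auto
  also have "(pd ?\<nu> ^^ m) (dbar_op f) z
      = \<tau> * (pd ?\<nu> ^^ m) (pd \<tau> f) z + ?\<nu> * (pd ?\<nu> ^^ m) (pd ?\<nu> f) z"
    using fold_dbar[of "replicate m ?\<nu>"] unfolding fold_pd_replicate .
  also have "(pd ?\<nu> ^^ m) (pd \<tau> f) z = 0"
    using Suc.prems(3) unfolding annihilates_def fold_pd_replicate[symmetric]
    by (auto dest!: spec[of _ "\<tau> # replicate m ?\<nu>"])
  finally show ?case by (simp add: funpow_swap1)
qed simp

end

subsection \<open>The index formula\<close>

text \<open>Such a function keeps its sign, so the loop stays in an open half-plane that omits
  0.\<close>

lemma winding_number_nonzero_real:
  fixes a :: "real \<Rightarrow> real"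
  assumes "continuous_on {0..1} a" "\<And>t. t \<in> {0..1} \<Longrightarrow> a t \<noteq> 0" "a 1 = a 0"
  shows "winding_number (\<lambda>t. complex_of_real (a t)) 0 = 0"
proof -
  have "connected (a ` {0..1})" using assms(1) by (intro connected_continuous_image) auto
  then have "is_interval (a ` {0..1})" by (simp add: is_interval_connected_1)
  moreover have "0 \<notin> a ` {0..1}" using assms(2) by (metis imageE)
  ultimately consider "a ` {0..1} \<subseteq> {0<..}" | "a ` {0..1} \<subseteq> {..<0}"
    unfolding is_interval_1 subset_iff greaterThan_iff lessThan_iff by (metis linorder_cases less_imp_le)
  then show ?thesis
  proof cases
    case 1
    then show ?thesis using assms
      by (intro winding_number_zero_outside[of _ "{z. Re z > 0}"])
        (auto simp: path_def path_image_def pathfinish_def pathstart_def convex_halfspace_Re_gt intro!: continuous_intros)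
  next
    case 2
    then show ?thesis using assms
      by (intro winding_number_zero_outside[of _ "{z. Re z < 0}"])
        (auto simp: path_def path_image_def pathfinish_def pathstart_def convex_halfspace_Re_lt intro!: continuous_intros)
  qed
qed

text \<open>Induction on the order: once all derivatives of order \<open>k\<close> are constant
  along the curve, their tangential derivatives vanish; together with the pure normal derivative of
  order \<open>k + 1\<close> this makes all derivatives of that order vanish on the curve. Normal
  derivatives up to order \<open>n\<close> thus control order \<open>n + 1\<close>.\<close>

lemma (in open_plane_set) annihilates_along_curve:
  assumes f: "smooth_on_C U f" and \<gamma>: "\<And>t. \<gamma> t \<in> U" "\<And>t. (\<gamma> has_vector_derivative \<tau> t) (at t)"
    and \<tau>: "\<And>t. norm (\<tau> t) = 1"
    and const: "\<And>t. f (\<gamma> t) = c"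
    and normal: "\<And>t j. 1 \<le> j \<Longrightarrow> j \<le> n \<Longrightarrow> (pd (\<i> * \<tau> t) ^^ j) f (\<gamma> t) = 0"
  shows "annihilates (Suc n) (\<tau> t) f (\<gamma> t)"
proof -
  have tangential: "pd (\<tau> t) g (\<gamma> t) = 0" if "smooth_on_C U g" "\<And>t. g (\<gamma> t) = b" for g b t
  proof -
    have "((\<lambda>t. g (\<gamma> t)) has_vector_derivative pd (\<tau> t) g (\<gamma> t)) (at t)"
      by (rule pd_chain[OF smooth_imp_differentiable[OF that(1) \<gamma>(1)] \<gamma>(2)])
    then have "((\<lambda>t. b) has_vector_derivative pd (\<tau> t) g (\<gamma> t)) (at t)" by (simp add: that(2))
    then show ?thesis using vector_derivative_unique_at has_vector_derivative_const by blast
  qed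
  have "annihilates (Suc k) (\<tau> t) f (\<gamma> t)" if "k \<le> n" for k t
    using that
  proof (induction k arbitrary: t)
    case 0
    show ?case
      using tangential[OF f const] by (intro annihilatesI[OF f \<gamma>(1)]) simp
  next
    case (Suc k)
    \<comment> \<open>The directions \<open>ws\<close> stay fixed while \<open>t\<close> varies,
      although the frame turns with \<open>t\<close>. So this is a function on the plane that is
      constant along the curve.\<close>
    have "fold pd ws f (\<gamma> t) = 0" if "length ws = Suc k" for ws t
      by (rule fold_pd_eq_0_if_annihilates[OF f \<gamma>(1) Suc.IH \<tau> normal that]) (use Suc.prems in auto)
    then show ?case
      by (intro annihilatesI[OF f \<gamma>(1)] tangential[OF smooth_fold_pd[OF f]])
  qed
  then show ?thesis by blast
qed

text \<open>The orientation is free: \<open>\<i>\<close> times the tangent is the inward or the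
  outward normal, and changing its sign only multiplies the \<open>j\<close>-th normal derivative by
  a sign.\<close>

theorem theorem3:
  fixes \<gamma> :: "real \<Rightarrow> complex" and L :: real and H :: "complex \<Rightarrow> real"
    and U D :: "complex set" and n :: nat
  assumes L_pos: "L > 0"
    and smooth_\<gamma>: "smooth_curve \<gamma>"
    and periodic: "\<And>t. \<gamma> (t + L) = \<gamma> t"
    and simple: "inj_on \<gamma> {0..<L}"
    and arclength: "\<And>t. norm (vector_derivative \<gamma> (at t)) = 1"
    and D_def: "D = \<gamma> ` {0..L} \<union> inside (\<gamma> ` {0..L})"
    and n_pos: "n \<ge> 1"
    and U_open: "open U" and D_sub: "D \<subseteq> U"
    and H_smooth: "smooth_on_C U (\<lambda>z. complex_of_real (H z))"
    and H_const: "\<exists>c. \<forall>t. H (\<gamma> t) = c"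
    and H_normal: "\<And>t j. 1 \<le> j \<Longrightarrow> j \<le> n - 1 \<Longrightarrow>
        (deriv ^^ j) (\<lambda>s. H (\<gamma> t + of_real s * (\<i> * vector_derivative \<gamma> (at t)))) 0 = 0"
    and isolated: "\<And>z. z \<in> D \<Longrightarrow> (dbar_op ^^ n) (\<lambda>w. complex_of_real (H w)) z = 0 \<Longrightarrow>
        \<exists>r>0. \<forall>w\<in>D \<inter> ball z r. w \<noteq> z \<longrightarrow> (dbar_op ^^ n) (\<lambda>w. complex_of_real (H w)) w \<noteq> 0"
    and no_boundary_zero: "\<And>t. (dbar_op ^^ n) (\<lambda>w. complex_of_real (H w)) (\<gamma> t) \<noteq> 0"
  shows "finite {z \<in> interior D. (dbar_op ^^ n) (\<lambda>w. complex_of_real (H w)) z = 0} \<and>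
    (\<Sum>z\<in>{z \<in> interior D. (dbar_op ^^ n) (\<lambda>w. complex_of_real (H w)) z = 0}.
        zero_index ((dbar_op ^^ n) (\<lambda>w. complex_of_real (H w))) z) = of_nat n"
proof -
  define \<tau> where "\<tau> t = vector_derivative \<gamma> (at t)" for t
  define f where "f = (\<lambda>w. complex_of_real (H w))"
  define V where "V = (dbar_op ^^ n) f"
  define a where "a t = Re ((pd (\<i> * \<tau> t) ^^ n) f (\<gamma> t))" for t
  have "\<gamma> differentiable_on UNIV" and d\<tau>: "\<tau> differentiable_on UNIV"
    using smooth_\<gamma>[unfolded smooth_curve_def, rule_format, of 0]
      smooth_\<gamma>[unfolded smooth_curve_def, rule_format, of 1] by (simp_all add: \<tau>_def[abs_def])
  then interpret unit_speed_loop \<gamma> \<tau> L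
    using L_pos periodic simple arclength differentiable_imp_continuous_on[OF d\<tau>]
    by unfold_locales (auto simp: \<tau>_def differentiable_on_def vector_derivative_works)
  interpret open_plane_set U by unfold_locales (rule U_open)
  have \<gamma>U: "\<gamma> t \<in> U" for t using range_\<gamma>[of t] D_sub D_def by blast
  have f: "smooth_on_C U f" unfolding f_def by (rule H_smooth)
  have V: "continuous_on U V" unfolding V_def by (intro smooth_imp_continuous_on smooth_funpow_dbar f)
  have real: "Im ((pd v ^^ m) f z) = 0" if "z \<in> U" for v m z
    by (rule funpow_pd_real[OF f _ that]) (simp add: f_def)
  have normal: "(pd (\<i> * \<tau> t) ^^ j) f (\<gamma> t) = 0" if "1 \<le> j" "j \<le> n - 1" for t j
    using H_normal[OF that, of t] funpow_deriv_line[OF H_smooth, of "\<gamma> t" 0 "\<i> * \<tau> t" j] \<gamma>U[of t]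
      real[OF \<gamma>U[of t], where m = j and v = "\<i> * \<tau> t"]
    by (simp add: complex_eq_iff \<tau>_def f_def)
  obtain c where c: "\<And>t. f (\<gamma> t) = c" using H_const unfolding f_def by metis
  \<comment> \<open>Vanishing up to order \<open>n - 1\<close> gives annihilation in order
    \<open>n\<close>; the \<open>n\<close>-th normal derivative itself remains and becomes the
    factor \<open>a\<close>.\<close>
  have "annihilates n (\<tau> t) f (\<gamma> t)" for t
    using annihilates_along_curve[of f \<gamma> \<tau> c "n - 1" t] f \<gamma>U deriv c normal n_pos by simp
  then have V\<gamma>: "V (\<gamma> t) = (\<i> * \<tau> t) ^ n * of_real (a t)" for t
    using funpow_dbar_if_annihilates[OF f \<gamma>U _ norm_\<tau>] real[OF \<gamma>U]
    by (simp add: V_def a_def complex_eq_iff)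
  have V_nz: "V (\<gamma> t) \<noteq> 0" for t using no_boundary_zero by (simp add: V_def f_def)
  have \<tau>_nz: "\<tau> t \<noteq> 0" for t using norm_\<tau>[of t] by fastforce
  have path_\<tau>: "path (\<lambda>t. \<tau> (L * t))"
    unfolding path_def by (intro continuous_on_compose2[OF cont_\<tau>] continuous_intros) auto
  have cont_V\<gamma>: "continuous_on UNIV (\<lambda>t. V (\<gamma> t))"
    using \<gamma>U by (intro continuous_on_compose2[OF V cont_\<gamma>]) auto
  \<comment> \<open>In this form continuity and periodicity of \<open>a\<close> follow from those of
    \<open>V\<close>, \<open>\<gamma>\<close> and \<open>\<tau>\<close>.\<close>
  have a_eq: "a t = Re (V (\<gamma> t) / (\<i> * \<tau> t) ^ n)" for t
    using \<tau>_nz by (simp add: V\<gamma>)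
  have a_nz: "a t \<noteq> 0" for t using V_nz[of t] V\<gamma>[of t] by auto
  have cont_a: "continuous_on UNIV a" unfolding a_eq
    using \<tau>_nz by (intro continuous_intros cont_V\<gamma> cont_\<tau>) auto
  have wind_a: "winding_number (\<lambda>t. complex_of_real (a (L * t))) 0 = 0"
    using a_nz a_eq periodic_int[of 0 1] periodic_\<tau>[of 0 1]
    by (intro winding_number_nonzero_real continuous_on_compose2[OF cont_a] continuous_intros) auto
  have wind_V: "winding_number (V \<circ> loop) 0 = of_nat n * winding_number (\<lambda>t. \<tau> (L * t)) 0"
  proof -
    have p: "path (\<lambda>t. \<i> * \<tau> (L * t))" "0 \<notin> path_image (\<lambda>t. \<i> * \<tau> (L * t))"
      using path_\<tau> \<tau>_nz by (auto simp: path_def path_image_def intro!: continuous_intros)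
    have eq: "V \<circ> loop = (\<lambda>t. (\<i> * \<tau> (L * t)) powi int n * of_real (a (L * t)))"
      by (simp add: fun_eq_iff V\<gamma>)
    have "winding_number (V \<circ> loop) 0 = winding_number (\<lambda>t. (\<i> * \<tau> (L * t)) powi int n) 0
        + winding_number (\<lambda>t. complex_of_real (a (L * t))) 0"
      unfolding eq by (intro winding_number_mult path_powi p)
        (use a_nz in \<open>auto simp: path_def path_image_def intro!: continuous_intros continuous_on_compose2[OF cont_a]\<close>)
    also have "\<dots> = of_nat n * winding_number (\<lambda>t. \<i> * \<tau> (L * t)) 0"
      using winding_number_powi[OF p, of "int n"] wind_a by simp
    also have "winding_number (\<lambda>t. \<i> * \<tau> (L * t)) 0
        = winding_number (\<lambda>t. \<i>) 0 + winding_number (\<lambda>t. \<tau> (L * t)) 0"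
      using \<tau>_nz by (intro winding_number_mult path_\<tau>) (auto simp: path_def path_image_def)
    also have "winding_number (\<lambda>t. \<i>) 0 = 0" by (rule winding_number_constI[of \<i>]) auto
    finally show ?thesis by (simp add: o_def)
  qed
  have D_outside: "- D = outside C" unfolding D_def union_with_inside by simp
  have Jordan: "bounded (inside C)" "open (inside C)" "open (outside C)" "connected (outside C)" "inside C \<noteq> {}"
    using Jordan_inside_outside[OF simple_path_loop closed_loop] unfolding path_image_loop by auto
  have "closed D" using D_outside Jordan(3) by (simp add: closed_def)
  moreover have "bounded D" unfolding D_def
    using Jordan(1) by (auto intro!: compact_imp_bounded compact_continuous_image cont_\<gamma> simp: bounded_Un)
  ultimately have D: "compact D" "connected (- D)" using Jordan(4) D_outside compact_eq_bounded_closed by auto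
  define Z where "Z = {z \<in> interior D. V z = 0}"
  have "C \<inter> {z. V z = 0} = {}" using V_nz by auto
  moreover have "inside C \<subseteq> interior D" using Jordan(2) D_def by (intro interior_maximal) auto
  ultimately have Z: "Z = D \<inter> {z. V z = 0}" "Z \<subseteq> inside C"
    using interior_subset[of D] unfolding Z_def D_def by blast+
  have VD: "continuous_on D V" using V D_sub continuous_on_subset by blast
  have cl: "closed (D \<inter> {z. V z = 0})"
    using continuous_closed_preimage[OF VD \<open>closed D\<close>, of "{0}"] by (simp add: vimage_def)
  \<comment> \<open>A limit point of the closed zero set would be a zero that is not isolated. By
    compactness of \<open>D\<close> there are finitely many zeros.\<close>
  have "\<not> z islimpt (D \<inter> {z. V z = 0})" for z
  proof
    assume z: "z islimpt (D \<inter> {z. V z = 0})"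
    then have "z \<in> D" "V z = 0" using cl unfolding closed_limpt by blast+
    then obtain r where r: "r > 0" "\<forall>w\<in>D \<inter> ball z r. w \<noteq> z \<longrightarrow> V w \<noteq> 0"
      using isolated unfolding V_def f_def by blast
    obtain w where "w \<in> D" "V w = 0" "w \<noteq> z" "dist w z < r"
      using z r(1) unfolding islimpt_approachable by blast
    then show False using r(2) by (simp add: dist_commute)
  qed
  then have "finite (D \<inter> (D \<inter> {z. V z = 0}))" by (intro finite_not_islimpt_in_compact D(1))
  then have finZ: "finite Z" using Z by simp
  obtain z0 where z0: "z0 \<in> inside C" using Jordan(5) by blast
  \<comment> \<open>The common winding number about inner points, 1 or -1, is a factor on both sides
    of the final equation and cancels.\<close>
  define \<sigma> where "\<sigma> = winding_number loop z0"
  have \<sigma>: "\<sigma> \<noteq> 0" "\<And>z. z \<in> inside C \<Longrightarrow> winding_number loop z = \<sigma>"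
    using simple_closed_path_winding_number_inside[OF simple_path_loop] z0
    unfolding path_image_loop \<sigma>_def by (metis zero_neq_one zero_neq_neg_one)+
  have "winding_number (V \<circ> loop) 0 = (\<Sum>z\<in>Z. zero_index V z * winding_number loop z)"
  proof (rule winding_number_eq_sum_zero_index[OF D _ finZ _ _ path_loop _ closed_loop])
    show "continuous_on D V" by (rule VD)
    show "path_image loop \<subseteq> D - Z" unfolding path_image_loop using V_nz by (auto simp: D_def Z_def)
  qed (use Z in \<open>auto simp: Z_def\<close>)
  also have "\<dots> = (\<Sum>z\<in>Z. zero_index V z) * \<sigma>"
    unfolding sum_distrib_right using \<sigma>(2) Z(2) by (intro sum.cong) auto
  finally have "of_nat n * \<sigma> = (\<Sum>z\<in>Z. zero_index V z) * \<sigma>"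
    unfolding wind_V winding_number_tangent[OF z0] \<sigma>_def[symmetric] .
  then have "(\<Sum>z\<in>Z. zero_index V z) = of_nat n" using \<sigma>(1) by (metis mult_right_cancel)
  with finZ show ?thesis unfolding Z_def V_def f_def by blast
qed

end
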